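(* Suppose that $m$ is an arbitrary absolutely continuous log-concave measure on $\mathbb{R}^n$. For any $f\in\mathcal{F}(\mathbb{R}^n)$ such that $\int e^{-f^*}\,dm>0$, it holds \[ \sup_{\nu\in\mathcal{P}_1(\mathbb{R}^n)}\left\{\int(-f)\,d\nu-K(\nu|m)\right\}=L(f|m). \] If $m$ and $f$ are further assumed to be unconditional (resp. symmetric), then the supremum above can be restricted to $\mathcal{P}_{u,1}(\mathbb{R}^n)$ (resp. $\mathcal{P}_{s,1}(\mathbb{R}^n)$).
   Context: A (not necessarily finite) absolutely continuous measure $m$ on $\mathbb{R}^n$ is log-concave if $dm=e^{-V}dx$ for some convex $V:\mathbb{R}^n\to\mathbb{R}\cup\{+\infty\}$. $\mathcal{F}(\mathbb{R}^n)$ is the set of lower semicontinuous convex functions $f:\mathbb{R}^n\to\mathbb{R}\cup\{+\infty\}$ finite at at least one point, and $f^*(y)=\sup_{x\in\mathbb{R}^n}\{x\cdot y-f(x)\}$. $\mathcal{P}_1(\mathbb{R}^n)$ is the set of Borel probability measures with finite first moment; for $f\in\mathcal{F}(\mathbb{R}^n)$ and $\nu\in\mathcal{P}_1(\mathbb{R}^n)$, $\int f\,d\nu$ is well defined in $\mathbb{R}\cup\{+\infty\}$. Functions/measures are symmetric if invariant under $x\mapsto-x$, unconditional if invariant under all maps $x\mapsto(\varepsilon_1x_1,\ldots,\varepsilon_nx_n)$, $\varepsilon\in\{-1,1\}^n$; $\mathcal{P}_{s,1}(\mathbb{R}^n)$ and $\mathcal{P}_{u,1}(\mathbb{R}^n)$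 are the symmetric, resp. unconditional, elements of $\mathcal{P}_1(\mathbb{R}^n)$. Define $L(f|m)=-\log\int e^{-f^*}\,dm$ for $f\in\mathcal{F}(\mathbb{R}^n)$ (with $\log0=-\infty$, $\log(+\infty)=+\infty$), and for $\nu\in\mathcal{P}_1(\mathbb{R}^n)$, \[ K(\nu|m)=\sup_{g\in L^1(\nu)\cap\mathcal{F}(\mathbb{R}^n)}\left\{\int(-g)\,d\nu-L(g|m)\right\}. \] *)

theory Defs
  imports "HOL-Probability.Probability"
begin

definition exp_ext :: "ereal \<Rightarrow> ennreal" where
  "exp_ext x = (case x of ereal r \<Rightarrow> ennreal (exp r) | PInfty \<Rightarrow> \<infinity> | MInfty \<Rightarrow> 0)"

definition ln_ext :: "ennreal \<Rightarrow> ereal" where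
  "ln_ext x = (if x = 0 then -\<infinity> else if x = \<infinity> then \<infinity> else ereal (ln (enn2real x)))"

text \<open>
  Positive part minus negative part. The difference is the usual extended integral as soon as
  one of the two parts is finite; when both are infinite, the value is the junk \<open>\<infinity> - \<infinity> = \<infinity>\<close>.
  For functions in \<open>lsc_convex\<close> (below) and measures with finite first moment the negative part is
  finite, because the function has an affine minorant.
\<close>
definition ext_integral :: "'a measure \<Rightarrow> ('a \<Rightarrow> ereal) \<Rightarrow> ereal" where
  "ext_integral M f =
     enn2ereal (\<integral>\<^sup>+x. e2ennreal (f x) \<partial>M) - enn2ereal (\<integral>\<^sup>+x. e2ennreal (- f x) \<partial>M)"

definition ext_integrable :: "'a measure \<Rightarrow> ('a \<Rightarrow> ereal) \<Rightarrow> bool" where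
  "ext_integrable M f \<longleftrightarrow> f \<in> borel_measurable M \<and> (\<integral>\<^sup>+x. e2ennreal \<bar>f x\<bar> \<partial>M) < \<infinity>"

text \<open>Convex functions with values in \<open>(-\<infinity>, \<infinity>]\<close>; the right-hand side is then never \<open>\<infinity> - \<infinity>\<close>.\<close>
definition ext_convex :: "('a::real_vector \<Rightarrow> ereal) \<Rightarrow> bool" where
  "ext_convex f \<longleftrightarrow> (\<forall>x. f x \<noteq> -\<infinity>) \<and>
     (\<forall>x y. \<forall>t::real. 0 < t \<and> t < 1 \<longrightarrow>
        f ((1 - t) *\<^sub>R x + t *\<^sub>R y) \<le> ereal (1 - t) * f x + ereal t * f y)"

definition lower_semicontinuous :: "('a::topological_space \<Rightarrow> ereal) \<Rightarrow> bool" where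
  "lower_semicontinuous f \<longleftrightarrow> (\<forall>x. f x \<le> Liminf (at x) f)"

definition lsc_convex :: "('a::real_normed_vector \<Rightarrow> ereal) set" where
  "lsc_convex = {f. lower_semicontinuous f \<and> ext_convex f \<and> (\<exists>x. f x \<noteq> \<infinity>)}"

definition legendre :: "('a::real_inner \<Rightarrow> ereal) \<Rightarrow> 'a \<Rightarrow> ereal" where
  "legendre f y = (SUP x. ereal (x \<bullet> y) - f x)"

text \<open>
  The measure lives on the Borel sets, but its density is integrated against \<open>lebesgue\<close>: an
  extended-valued convex function is always Lebesgue measurable, but need not be Borel measurable
  (it can be arbitrary on a part of the boundary of its domain), and \<open>density lborel\<close> presupposes
  a Borel measurable density. The measure may be infinite.
\<close>
definition log_concave_measure :: "'a::euclidean_space measure \<Rightarrow> bool" where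
  "log_concave_measure m \<longleftrightarrow> sets m = sets borel \<and>
     (\<exists>V. ext_convex V \<and>
        (\<forall>A\<in>sets borel. emeasure m A = (\<integral>\<^sup>+x\<in>A. exp_ext (- V x) \<partial>lebesgue)))"

definition P1 :: "'a::euclidean_space measure set" where
  "P1 = {\<nu>. sets \<nu> = sets borel \<and> prob_space \<nu> \<and> integrable \<nu> norm}"

definition sym_fun :: "('a::real_vector \<Rightarrow> ereal) \<Rightarrow> bool" where
  "sym_fun f \<longleftrightarrow> (\<forall>x. f (- x) = f x)"

definition sym_measure :: "'a::real_normed_vector measure \<Rightarrow> bool" where
  "sym_measure \<nu> \<longleftrightarrow> distr \<nu> borel uminus = \<nu>"

definition flip :: "('n \<Rightarrow> real) \<Rightarrow> real^'n \<Rightarrow> real^'n" where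
  "flip \<epsilon> x = (\<chi> i. \<epsilon> i * x $ i)"

definition uncond_fun :: "(real^'n \<Rightarrow> ereal) \<Rightarrow> bool" where
  "uncond_fun f \<longleftrightarrow> (\<forall>\<epsilon>. (\<forall>i. \<epsilon> i \<in> {-1, 1}) \<longrightarrow> (\<forall>x. f (flip \<epsilon> x) = f x))"

definition uncond_measure :: "(real^'n) measure \<Rightarrow> bool" where
  "uncond_measure \<nu> \<longleftrightarrow> (\<forall>\<epsilon>. (\<forall>i. \<epsilon> i \<in> {-1, 1}) \<longrightarrow> distr \<nu> borel (flip \<epsilon>) = \<nu>)"

definition Ps1 :: "'a::euclidean_space measure set" where
  "Ps1 = {\<nu> \<in> P1. sym_measure \<nu>}"

definition Pu1 :: "(real^'n) measure set" where
  "Pu1 = {\<nu> \<in> P1. uncond_measure \<nu>}"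

definition L_fun :: "('a::euclidean_space \<Rightarrow> ereal) \<Rightarrow> 'a measure \<Rightarrow> ereal" where
  "L_fun f m = - ln_ext (\<integral>\<^sup>+y. exp_ext (- legendre f y) \<partial>m)"

definition K_fun :: "'a::euclidean_space measure \<Rightarrow> 'a measure \<Rightarrow> ereal" where
  "K_fun \<nu> m = (SUP g \<in> {g \<in> lsc_convex. ext_integrable \<nu> g}.
     ext_integral \<nu> (\<lambda>x. - g x) - L_fun g m)"

end

theory Submission
  imports Defs
begin

text \<open>
  The inequality \<open>\<le>\<close> is immediate from the definition of \<open>K\<close> by taking \<open>g = f\<close>. If \<open>f\<close> is not
  \<open>\<nu>\<close>-integrable, the left-hand side is \<open>-\<infinity>\<close>, provided \<open>K\<close> is never \<open>-\<infinity>\<close>; this holds because the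
  competitor \<open>R |x|\<close> is integrable for every \<open>\<nu>\<close> in \<open>P1\<close> and has a transform that is at most zero on
  the ball of radius \<open>R\<close>, which is charged by \<open>m\<close> once \<open>R\<close> is large (lemma \<open>weak_duality\<close>).

  For \<open>\<ge>\<close> one wants \<open>-\<nu>\<close> to be a subgradient of the convex functional \<open>g \<mapsto> L(g|m)\<close> near \<open>f\<close>. The natural
  candidate, the image of \<open>exp(-f*) dm\<close> under the gradient of \<open>f*\<close>, can fail when \<open>f*\<close> jumps to \<open>\<infinity>\<close>
  at the boundary of its domain. Instead, \<open>f*\<close> is written as the supremum of countably many affine
  functions \<open>y \<mapsto> x\<^sub>i \<bullet> y - c\<^sub>i\<close> with \<open>c\<^sub>i = f(x\<^sub>i)\<close> and approximated from below by the finite maxima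
  \<open>\<phi>\<^sub>N\<close>. Each \<open>\<phi>\<^sub>N\<close> is finite everywhere, and the gradient image of its Gibbs measure is a convex
  combination \<open>\<nu> = \<Sum> p\<^sub>i \<delta>(x\<^sub>i)\<close>, with \<open>p\<^sub>i\<close> the Gibbs mass of the cell where the \<open>i\<close>-th affine
  function is maximal. For a competitor \<open>g\<close>, the Prekopa--Leindler inequality applied to the maximum of
  the functions \<open>x\<^sub>i \<bullet> y - (1 - t) c\<^sub>i - t g(x\<^sub>i)\<close> yields, with \<open>Z\<^sub>N\<close> the integral of \<open>exp(-\<phi>\<^sub>N) dm\<close>
  and to first order in \<open>t\<close>, \<open>ln (\<integral> exp(-g*) dm) \<le> ln Z\<^sub>N + \<Sum> p\<^sub>i (g(x\<^sub>i) - c\<^sub>i)\<close>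
  (lemma \<open>gibbs_variational_inequality\<close>). This says \<open>\<integral>(-f) d\<nu> - K(\<nu>|m) \<ge> - ln Z\<^sub>N\<close>.

  It remains to let \<open>N\<close> tend to infinity. Monotone convergence for the decreasing integrands needs one
  finite \<open>Z\<^sub>N\<close>, which is the content of \<open>affine_max_integrable\<close>: a log-concave density with finite positive
  integral has bounded superlevel sets, a compactness argument on a sphere shows that finitely many of the affine
  functions suffice for this, and convexity turns it into exponential decay.

  The inequality for \<open>\<nu>\<close> holds for every function \<open>g\<close> that is finite at the relevant points, so it may be
  applied to \<open>g \<circ> h\<close> for each \<open>h\<close> in a finite group of orthogonal maps preserving \<open>m\<close> and \<open>f\<close>, and
  averaged. Hence \<open>\<nu>\<close> can be replaced by its average over the group. The trivial group, the group generated
  by \<open>x \<mapsto> -x\<close> and the group of sign changes give the three parts of the theorem.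
\<close>

section \<open>The Prekopa--Leindler inequality\<close>

text \<open>
  The inequality \<open>a\<^sup>1\<^sup>-\<^sup>t b\<^sup>t \<le> c\<close>, tested on finite positive lower bounds of \<open>a\<close> and \<open>b\<close>. This avoids real
  powers of extended numbers, is vacuous when \<open>a\<close> or \<open>b\<close> is zero, and passes to monotone limits in \<open>a\<close> and \<open>b\<close>.
\<close>
definition geom_mean_le :: "real \<Rightarrow> ennreal \<Rightarrow> ennreal \<Rightarrow> ennreal \<Rightarrow> bool" where
  "geom_mean_le t a b c \<longleftrightarrow>
     (\<forall>u v. ennreal (exp u) < a \<longrightarrow> ennreal (exp v) < b \<longrightarrow> ennreal (exp ((1 - t) * u + t * v)) \<le> c)"

text \<open>
  Inner regularity is a statement about finite measures, so Lebesgue measure is first restricted to a large ball.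
\<close>
lemma lborel_inner_compact:
  fixes A :: "'a::euclidean_space set"
  assumes [measurable]: "A \<in> sets borel" and "c < emeasure lborel A"
  obtains K where "compact K" "K \<subseteq> A" "c < emeasure lborel K"
proof -
  have "(SUP n. emeasure lborel (A \<inter> cball 0 (real n))) = emeasure lborel (\<Union>n. A \<inter> cball 0 (real n))"
    by (rule SUP_emeasure_incseq) (auto simp: incseq_def)
  also have "(\<Union>n. A \<inter> cball 0 (real n)) = A"
    using real_arch_simple by auto
  finally have "c < (SUP n. emeasure lborel (A \<inter> cball 0 (real n)))"
    using assms(2) by simp
  then obtain n :: nat where n: "c < emeasure lborel (A \<inter> cball 0 (real n))"
    unfolding less_SUP_iff by blast
  define M where "M = density lborel (indicator (cball 0 (real n)) :: 'a \<Rightarrow> ennreal)"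
  have M: "emeasure M B = emeasure lborel (B \<inter> cball 0 (real n))" if [measurable]: "B \<in> sets borel" for B
  proof -
    have "emeasure M B = (\<integral>\<^sup>+x. indicator (cball 0 (real n)) x * indicator B x \<partial>lborel)"
      unfolding M_def by (rule emeasure_density) (auto intro!: borel_measurable_indicator)
    also have "\<dots> = (\<integral>\<^sup>+x. indicator (B \<inter> cball 0 (real n)) x \<partial>lborel)"
      by (rule nn_integral_cong) (auto simp: indicator_def)
    also have "\<dots> = emeasure lborel (B \<inter> cball 0 (real n))"
      by (rule nn_integral_indicator) auto
    finally show ?thesis .
  qed
  have "emeasure M A = (SUP K \<in> {K. K \<subseteq> A \<and> compact K}. emeasure M K)"
  proof (rule inner_regular)
    have "emeasure M UNIV = emeasure lborel (cball 0 (real n) :: 'a set)" using M[of UNIV] by simp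
    moreover have "space M = UNIV" by (simp add: M_def)
    ultimately show "emeasure M (space M) \<noteq> \<infinity>"
      using emeasure_lborel_cball_finite[of "0 :: 'a" "real n"] by simp
  qed (simp_all add: M_def)
  then have "c < (SUP K \<in> {K. K \<subseteq> A \<and> compact K}. emeasure M K)"
    using n M[of A] by simp
  then obtain K where K: "K \<subseteq> A" "compact K" "c < emeasure M K"
    unfolding less_SUP_iff by blast
  have "K \<in> sets borel" using K(2) by (simp add: borel_compact)
  then have "emeasure M K \<le> emeasure lborel K"
    unfolding M[OF \<open>K \<in> sets borel\<close>] by (intro emeasure_mono) auto
  with K show ?thesis by (intro that[of K]) auto
qed

lemma emeasure_real_affine_compact:
  fixes K :: "real set"
  assumes "compact K" "0 < c"
  shows "emeasure lborel ((\<lambda>x. d + c * x) ` K) = ennreal c * emeasure lborel K"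
proof -
  have 1: "emeasure lebesgue ((\<lambda>x. c *\<^sub>R x + d) ` K) = \<bar>c\<bar> ^ DIM(real) * emeasure lebesgue K"
    using emeasure_lebesgue_affine[of c d K] by (simp add: add.commute)
  have "compact ((\<lambda>x. d + c * x) ` K)"
    by (intro compact_continuous_image continuous_intros assms)
  then show ?thesis using 1 assms borel_compact[OF assms(1)] borel_compact[of "(\<lambda>x. d + c * x) ` K"]
    by (simp add: add.commute)
qed

text \<open>
  Two compact sets, placed so that the maximum of the first equals the minimum of the second, overlap in one
  point only; translates of this kind of \<open>(1 - t) A\<close> and \<open>t B\<close> both lie inside the Minkowski combination.
  The general case is a supremum over compact subsets.
\<close>
lemma brunn_minkowski_real:
  fixes A B C :: "real set"
  assumes [measurable]: "A \<in> sets borel" "B \<in> sets borel" "C \<in> sets borel"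
    and ne: "A \<noteq> {}" "B \<noteq> {}" and t: "0 < t" "t < 1"
    and C: "\<And>a b. a \<in> A \<Longrightarrow> b \<in> B \<Longrightarrow> (1 - t) * a + t * b \<in> C"
  shows "ennreal (1 - t) * emeasure lborel A + ennreal t * emeasure lborel B \<le> emeasure lborel C"
proof -
  have cpt: "ennreal (1 - t) * emeasure lborel K + ennreal t * emeasure lborel L \<le> emeasure lborel C"
    if K: "compact K" "K \<subseteq> A" "K \<noteq> {}" and L: "compact L" "L \<subseteq> B" "L \<noteq> {}" for K L
  proof -
    obtain k where k: "k \<in> K" "\<And>x. x \<in> K \<Longrightarrow> x \<le> k" using compact_attains_sup[OF K(1,3)] by blast
    obtain l where l: "l \<in> L" "\<And>x. x \<in> L \<Longrightarrow> l \<le> x" using compact_attains_inf[OF L(1,3)] by blast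
    define K' where "K' = (\<lambda>x. t * l + (1 - t) * x) ` K"
    define L' where "L' = (\<lambda>x. (1 - t) * k + t * x) ` L"
    define z where "z = (1 - t) * k + t * l"
    have "compact K'" "compact L'" unfolding K'_def L'_def
      by (intro compact_continuous_image continuous_intros K L)+
    then have [measurable]: "K' \<in> sets borel" "L' \<in> sets borel" by (auto intro: borel_compact)
    have le: "x \<le> z" if "x \<in> K'" for x
      using that k(2) t unfolding K'_def z_def by (auto intro!: mult_left_mono)
    have ge: "z \<le> x" if "x \<in> L'" for x
      using that l(2) t unfolding L'_def z_def by (auto intro!: mult_left_mono)
    (* The two sets meet at most in z; removing this null point makes them disjoint. *)
    have disj: "K' \<inter> (L' - {z}) = {}" using le ge by force
    have "ennreal (1 - t) * emeasure lborel K + ennreal t * emeasure lborel L = emeasure lborel K' + emeasure lborel L'"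
      unfolding K'_def L'_def using t K L by (simp add: emeasure_real_affine_compact)
    also have "emeasure lborel L' = emeasure lborel (L' - {z})"
      by (rule emeasure_Diff_null_set[symmetric]) (auto simp: null_sets_def)
    also have "emeasure lborel K' + emeasure lborel (L' - {z}) = emeasure lborel (K' \<union> (L' - {z}))"
      by (rule plus_emeasure) (use disj in auto)
    also have "\<dots> \<le> emeasure lborel C"
    proof (rule emeasure_mono)
      show "K' \<union> (L' - {z}) \<subseteq> C"
        using C k(1) l(1) K L unfolding K'_def L'_def by (fastforce simp: add.commute)
    qed simp
    finally show ?thesis .
  qed
  have approx: "\<exists>K. compact K \<and> K \<subseteq> S \<and> K \<noteq> {} \<and> c \<le> emeasure lborel K"
    if S: "S \<in> sets borel" "S \<noteq> {}" "c < emeasure lborel S \<or> c = 0" for S :: "real set" and c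
  proof (cases "c < emeasure lborel S")
    case True
    then obtain K where "compact K" "K \<subseteq> S" "c < emeasure lborel K"
      by (rule lborel_inner_compact[OF S(1)])
    then show ?thesis by (intro exI[of _ K]) auto
  next
    case False
    obtain s where "s \<in> S" using S by auto
    then show ?thesis using False S by (intro exI[of _ "{s}"]) auto
  qed
  have sup: "emeasure lborel S = (SUP K \<in> {K. compact K \<and> K \<subseteq> S \<and> K \<noteq> {}}. emeasure lborel K)"
    if S: "S \<in> sets borel" "S \<noteq> {}" for S :: "real set"
  proof (rule antisym)
    show "emeasure lborel S \<le> (SUP K \<in> {K. compact K \<and> K \<subseteq> S \<and> K \<noteq> {}}. emeasure lborel K)"
    proof (rule dense_le)
      fix c assume "c < emeasure lborel S"
      then show "c \<le> (SUP K \<in> {K. compact K \<and> K \<subseteq> S \<and> K \<noteq> {}}. emeasure lborel K)"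
        using approx[OF S, of c] by (auto intro: SUP_upper2)
    qed
    show "(SUP K \<in> {K. compact K \<and> K \<subseteq> S \<and> K \<noteq> {}}. emeasure lborel K) \<le> emeasure lborel S"
      using S by (auto intro!: SUP_least emeasure_mono)
  qed
  have ne': "{K. compact K \<and> K \<subseteq> S \<and> K \<noteq> {}} \<noteq> {}" if "S \<noteq> {}" for S :: "real set"
    using that by (auto intro!: exI[of _ "{SOME x. x \<in> S}"] simp: some_in_eq)
  have "ennreal (1 - t) * emeasure lborel K + ennreal t * emeasure lborel B \<le> emeasure lborel C"
    if "compact K" "K \<subseteq> A" "K \<noteq> {}" for K
    unfolding sup[OF assms(2) ne(2)] SUP_mult_left_ennreal ennreal_SUP_add_right[OF ne'[OF ne(2)]]
    by (rule SUP_least) (use cpt that in auto)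
  then show ?thesis
    unfolding sup[OF assms(1) ne(1)] SUP_mult_left_ennreal ennreal_SUP_add_left[OF ne'[OF ne(1)], symmetric]
    by (intro SUP_least) auto
qed

lemma nn_integral_layer_cake:
  fixes f :: "real \<Rightarrow> ennreal"
  assumes [measurable]: "f \<in> borel_measurable borel" and le: "\<And>x. f x \<le> 1"
  shows "(\<integral>\<^sup>+x. f x \<partial>lborel) = (\<integral>\<^sup>+s. indicator {0<..<1} s * emeasure lborel {x. ennreal s < f x} \<partial>lborel)"
proof -
  have 1: "f x = (\<integral>\<^sup>+s. indicator {0<..<1} s * indicator {s. ennreal s < f x} s \<partial>lborel)" for x
  proof -
    obtain r where r: "0 \<le> r" "f x = ennreal r" "r \<le> 1"
      using le[of x] by (cases "f x") (auto simp: top_unique)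
    have "(\<integral>\<^sup>+s. indicator {0<..<1} s * indicator {s. ennreal s < f x} s \<partial>lborel)
        = (\<integral>\<^sup>+s. indicator {0<..<r} s \<partial>lborel)"
      by (rule nn_integral_cong) (use r in \<open>auto simp: indicator_def ennreal_less_iff\<close>)
    also have "\<dots> = f x" using r by simp
    finally show ?thesis by simp
  qed
  have "(\<integral>\<^sup>+x. f x \<partial>lborel) = (\<integral>\<^sup>+x. (\<integral>\<^sup>+s. indicator {0<..<1} s * indicator {s. ennreal s < f x} s \<partial>lborel) \<partial>lborel)"
    using 1 by simp
  also have "\<dots> = (\<integral>\<^sup>+s. (\<integral>\<^sup>+x. indicator {0<..<1} s * indicator {s. ennreal s < f x} s \<partial>lborel) \<partial>lborel)"
    by (rule pair_sigma_finite.Fubini') (simp_all add: pair_sigma_finite_def lborel.sigma_finite_measure_axioms)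
  also have "\<dots> = (\<integral>\<^sup>+s. indicator {0<..<1} s * emeasure lborel {x. ennreal s < f x} \<partial>lborel)"
  proof (rule nn_integral_cong)
    fix s :: real
    have "(\<integral>\<^sup>+x. indicator {s. ennreal s < f x} s \<partial>lborel) = (\<integral>\<^sup>+x. indicator {x. ennreal s < f x} x \<partial>lborel)"
      by (rule nn_integral_cong) (auto simp: indicator_def)
    also have "\<dots> = emeasure lborel {x. ennreal s < f x}"
      by (subst nn_integral_indicator) auto
    finally show "(\<integral>\<^sup>+x. indicator {0<..<1} s * indicator {s. ennreal s < f x} s \<partial>lborel)
        = indicator {0<..<1} s * emeasure lborel {x. ennreal s < f x}"
      by (subst nn_integral_cmult) (auto simp: indicator_def)
  qed
  finally show ?thesis .
qed

text \<open>
  When both suprema equal one, the superlevel sets of \<open>f\<close> and \<open>g\<close> are nonempty for the same levels \<open>s < 1\<close>,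
  so the Brunn--Minkowski inequality can be integrated over the level. The conclusion is even arithmetic
  rather than geometric.
\<close>
lemma prekopa_leindler_real_normalized:
  fixes f g h :: "real \<Rightarrow> ennreal"
  assumes [measurable]: "f \<in> borel_measurable borel" "g \<in> borel_measurable borel" "h \<in> borel_measurable borel"
    and t: "0 < t" "t < 1"
    and f1: "\<And>x. f x \<le> 1" "\<And>s. s < 1 \<Longrightarrow> \<exists>x. s < f x"
    and g1: "\<And>x. g x \<le> 1" "\<And>s. s < 1 \<Longrightarrow> \<exists>x. s < g x"
    and h: "\<And>x y s. 0 < s \<Longrightarrow> s < 1 \<Longrightarrow> ennreal s < f x \<Longrightarrow> ennreal s < g y \<Longrightarrow> ennreal s < h ((1 - t) * x + t * y)"
  shows "ennreal (1 - t) * (\<integral>\<^sup>+x. f x \<partial>lborel) + ennreal t * (\<integral>\<^sup>+x. g x \<partial>lborel) \<le> (\<integral>\<^sup>+x. h x \<partial>lborel)"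
proof -
  (* The layer cake formula is over levels in (0, 1) only, so h is cut off at 1. *)
  define k where "k x = min (h x) 1" for x
  have [measurable]: "k \<in> borel_measurable borel" unfolding k_def by measurable
  have "ennreal (1 - t) * (\<integral>\<^sup>+x. f x \<partial>lborel) + ennreal t * (\<integral>\<^sup>+x. g x \<partial>lborel)
    = (\<integral>\<^sup>+s. ennreal (1 - t) * (indicator {0<..<1} s * emeasure lborel {x. ennreal s < f x})
        + ennreal t * (indicator {0<..<1} s * emeasure lborel {x. ennreal s < g x}) \<partial>lborel)"
    by (simp add: nn_integral_add nn_integral_cmult nn_integral_layer_cake f1 g1)
  also have "\<dots> \<le> (\<integral>\<^sup>+s. indicator {0<..<1} s * emeasure lborel {x. ennreal s < k x} \<partial>lborel)"
  proof (rule nn_integral_mono)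
    fix s :: real
    have "ennreal (1 - t) * emeasure lborel {x. ennreal s < f x} + ennreal t * emeasure lborel {x. ennreal s < g x}
        \<le> emeasure lborel {x. ennreal s < k x}" if s: "0 < s" "s < 1"
      using f1(2)[of s] g1(2)[of s] s h[OF s]
      by (intro brunn_minkowski_real t) (auto simp: k_def ennreal_less_one_iff)
    then show "ennreal (1 - t) * (indicator {0<..<1} s * emeasure lborel {x. ennreal s < f x})
        + ennreal t * (indicator {0<..<1} s * emeasure lborel {x. ennreal s < g x})
       \<le> indicator {0<..<1} s * emeasure lborel {x. ennreal s < k x}"
      by (auto simp: indicator_def)
  qed
  also have "\<dots> = (\<integral>\<^sup>+x. k x \<partial>lborel)"
    by (rule nn_integral_layer_cake[symmetric]) (auto simp: k_def)
  also have "\<dots> \<le> (\<integral>\<^sup>+x. h x \<partial>lborel)"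
    by (rule nn_integral_mono) (auto simp: k_def)
  finally show ?thesis .
qed

lemma geom_mean_leI:
  assumes "\<And>u v. ennreal (exp u) < a \<Longrightarrow> ennreal (exp v) < b \<Longrightarrow> ennreal (exp ((1 - t) * u + t * v)) \<le> c"
  shows "geom_mean_le t a b c"
  using assms by (auto simp: geom_mean_le_def)

lemma geom_mean_leD:
  assumes "geom_mean_le t a b c" "ennreal (exp u) < a" "ennreal (exp v) < b"
  shows "ennreal (exp ((1 - t) * u + t * v)) \<le> c"
  using assms by (auto simp: geom_mean_le_def)

text \<open>
  Dividing \<open>f\<close> and \<open>g\<close> by their suprema \<open>e\<^sup>p\<close> and \<open>e\<^sup>q\<close>, and \<open>h\<close> by \<open>e\<^sup>r\<close> with \<open>r = (1 - t) p + t q\<close>,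
  reduces to the normalised case; convexity of \<open>exp\<close> then passes from the arithmetic to the geometric mean.
\<close>
lemma prekopa_leindler_real_bounded:
  fixes f g h :: "real \<Rightarrow> ennreal"
  assumes [measurable]: "f \<in> borel_measurable borel" "g \<in> borel_measurable borel" "h \<in> borel_measurable borel"
    and t: "0 < t" "t < 1"
    and bounded: "(SUP x. f x) < \<infinity>" "(SUP x. g x) < \<infinity>"
    and h: "\<And>x y. geom_mean_le t (f x) (g y) (h ((1 - t) * x + t * y))"
  shows "geom_mean_le t (\<integral>\<^sup>+x. f x \<partial>lborel) (\<integral>\<^sup>+x. g x \<partial>lborel) (\<integral>\<^sup>+x. h x \<partial>lborel)"
proof (rule geom_mean_leI)
  fix u v
  assume u: "ennreal (exp u) < (\<integral>\<^sup>+x. f x \<partial>lborel)" and v: "ennreal (exp v) < (\<integral>\<^sup>+x. g x \<partial>lborel)"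
  have sup_exp: "\<exists>p. (SUP x. k x) = ennreal (exp p)"
    if k: "(SUP x. k x) < \<infinity>" "ennreal (exp w) < (\<integral>\<^sup>+x. k x \<partial>lborel)" for k :: "real \<Rightarrow> ennreal" and w
  proof -
    have "(SUP x. k x) \<noteq> 0"
    proof
      assume "(SUP x. k x) = 0"
      then have "k x = 0" for x using SUP_upper[of x UNIV k] by simp
      with that show False by simp
    qed
    moreover obtain r where r: "0 \<le> r" "(SUP x. k x) = ennreal r"
      using k(1) unfolding infinity_ennreal_def less_top_ennreal by blast
    ultimately have "0 < r" by (cases "r = 0") auto
    with r show ?thesis by (intro exI[of _ "ln r"]) simp
  qed
  obtain p where p: "(SUP x. f x) = ennreal (exp p)" using sup_exp[OF bounded(1) u] by blast
  obtain q where q: "(SUP x. g x) = ennreal (exp q)" using sup_exp[OF bounded(2) v] by blast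
  define r where "r = (1 - t) * p + t * q"
  define F where "F x = ennreal (exp (- p)) * f x" for x
  define G where "G x = ennreal (exp (- q)) * g x" for x
  define H where "H x = ennreal (exp (- r)) * h x" for x
  have scale: "ennreal s < ennreal (exp (- w)) * z \<longleftrightarrow> ennreal (exp w * s) < z" if "0 < s" for s w z
    using that by (cases z) (auto simp: ennreal_mult[symmetric] ennreal_less_iff exp_minus field_simps ennreal_mult_top)
  have scale_le: "ennreal s \<le> ennreal (exp (- w)) * z \<longleftrightarrow> ennreal (exp w * s) \<le> z" if "0 < s" for s w z
    using that by (cases z) (auto simp: ennreal_mult[symmetric] ennreal_le_iff2 exp_minus field_simps ennreal_mult_top)
  have norm1: "ennreal (exp (- w)) * k x \<le> 1" and norm2: "s < 1 \<Longrightarrow> \<exists>x. s < ennreal (exp (- w)) * k x"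
    if "(SUP x. k x) = ennreal (exp w)" for k :: "real \<Rightarrow> ennreal" and x s w
  proof -
    have "ennreal (exp (- w)) * k x \<le> ennreal (exp (- w)) * ennreal (exp w)"
      by (rule mult_left_mono) (auto simp: that[symmetric] intro: SUP_upper)
    then show "ennreal (exp (- w)) * k x \<le> 1" by (simp add: ennreal_mult[symmetric] exp_minus)
    assume "s < 1"
    have "(SUP x. ennreal (exp (- w)) * k x) = 1"
      unfolding SUP_mult_left_ennreal[symmetric] that by (simp add: ennreal_mult[symmetric] exp_minus)
    with \<open>s < 1\<close> have "s < (SUP x. ennreal (exp (- w)) * k x)" by simp
    then show "\<exists>x. s < ennreal (exp (- w)) * k x" unfolding less_SUP_iff by blast
  qed
  have "ennreal (1 - t) * (\<integral>\<^sup>+x. F x \<partial>lborel) + ennreal t * (\<integral>\<^sup>+x. G x \<partial>lborel) \<le> (\<integral>\<^sup>+x. H x \<partial>lborel)"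
  proof (rule prekopa_leindler_real_normalized[OF _ _ _ t])
    fix x y s :: real
    assume s: "0 < s" "s < 1" "ennreal s < F x" "ennreal s < G y"
    (* The hypothesis gives only a weak inequality for h, so the level is first raised slightly. *)
    obtain s' where s': "s < s'" "ennreal s' < F x" "ennreal s' < G y"
    proof -
      obtain a where "ennreal s < a" "a < min (F x) (G y)" using dense[of "ennreal s" "min (F x) (G y)"] s by auto
      moreover then obtain b where "a = ennreal b" "0 \<le> b" by (cases a) auto
      ultimately show thesis using s by (intro that[of b]) (auto simp: ennreal_less_iff)
    qed
    have "ennreal (exp (p + ln s')) < f x" "ennreal (exp (q + ln s')) < g y"
      using s s' by (auto simp: F_def G_def scale exp_add)
    from geom_mean_leD[OF h this]
    have "ennreal (exp ((1 - t) * (p + ln s') + t * (q + ln s'))) \<le> h ((1 - t) * x + t * y)" .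
    also have "(1 - t) * (p + ln s') + t * (q + ln s') = r + ln s'" by (simp add: r_def algebra_simps)
    also have "exp (r + ln s') = exp r * s'" using s s' by (simp add: exp_add)
    finally have "ennreal s' \<le> H ((1 - t) * x + t * y)" using s s' by (simp add: H_def scale_le)
    moreover have "ennreal s < ennreal s'" using s(1) s'(1) by (intro ennreal_lessI) auto
    ultimately show "ennreal s < H ((1 - t) * x + t * y)" by (rule less_le_trans[rotated])
  qed (use norm1[OF p] norm2[OF p] norm1[OF q] norm2[OF q] in \<open>auto simp: F_def G_def H_def\<close>)
  also have "(\<integral>\<^sup>+x. H x \<partial>lborel) = ennreal (exp (- r)) * (\<integral>\<^sup>+x. h x \<partial>lborel)"
    unfolding H_def by (rule nn_integral_cmult) simp
  finally have main: "ennreal (1 - t) * (\<integral>\<^sup>+x. F x \<partial>lborel) + ennreal t * (\<integral>\<^sup>+x. G x \<partial>lborel)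
      \<le> ennreal (exp (- r)) * (\<integral>\<^sup>+x. h x \<partial>lborel)" .
  have "ennreal (exp (u - p)) \<le> (\<integral>\<^sup>+x. F x \<partial>lborel)"
    using u by (simp add: F_def nn_integral_cmult scale_le exp_add[symmetric])
  moreover have "ennreal (exp (v - q)) \<le> (\<integral>\<^sup>+x. G x \<partial>lborel)"
    using v by (simp add: G_def nn_integral_cmult scale_le exp_add[symmetric])
  ultimately have "ennreal (1 - t) * ennreal (exp (u - p)) + ennreal t * ennreal (exp (v - q))
      \<le> ennreal (exp (- r)) * (\<integral>\<^sup>+x. h x \<partial>lborel)"
    by (intro order_trans[OF _ main] add_mono mult_left_mono) auto
  moreover have "exp ((1 - t) * (u - p) + t * (v - q)) \<le> (1 - t) * exp (u - p) + t * exp (v - q)"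
    using convex_onD[OF exp_convex, of t "u - p" "v - q"] t by (simp add: algebra_simps)
  then have "ennreal (exp ((1 - t) * (u - p) + t * (v - q))) \<le> ennreal (1 - t) * ennreal (exp (u - p)) + ennreal t * ennreal (exp (v - q))"
    using t by (simp add: ennreal_mult[symmetric] ennreal_plus[symmetric] del: ennreal_plus)
  ultimately have "ennreal (exp ((1 - t) * (u - p) + t * (v - q))) \<le> ennreal (exp (- r)) * (\<integral>\<^sup>+x. h x \<partial>lborel)"
    by (rule order_trans[rotated])
  then have "ennreal (exp (r + ((1 - t) * (u - p) + t * (v - q)))) \<le> (\<integral>\<^sup>+x. h x \<partial>lborel)"
    by (simp add: scale_le exp_add)
  moreover have "r + ((1 - t) * (u - p) + t * (v - q)) = (1 - t) * u + t * v"
    by (simp add: r_def algebra_simps)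
  ultimately show "ennreal (exp ((1 - t) * u + t * v)) \<le> (\<integral>\<^sup>+x. h x \<partial>lborel)" by simp
qed

lemma nn_integral_truncate:
  assumes [measurable]: "f \<in> borel_measurable M"
  shows "(SUP n. \<integral>\<^sup>+x. min (f x) (of_nat n) \<partial>M) = (\<integral>\<^sup>+x. f x \<partial>M)"
proof -
  have inc: "min (f x) (of_nat n) \<le> min (f x) (of_nat (Suc n))" for x n
    by (intro min.mono order_refl) (simp only: of_nat_le_iff)
  have "(SUP n. min (f x) (of_nat n)) = f x" for x
  proof (rule antisym)
    show "f x \<le> (SUP n. min (f x) (of_nat n))"
    proof (rule dense_le)
      fix c assume "c < f x"
      then have "c < top" by (rule less_le_trans) simp
      then obtain n :: nat where "c < of_nat n" using ennreal_Ex_less_of_nat by blast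
      with \<open>c < f x\<close> show "c \<le> (SUP n. min (f x) (of_nat n))" by (intro SUP_upper2[of n]) auto
    qed
  qed (auto intro: SUP_least)
  then have "(\<integral>\<^sup>+x. f x \<partial>M) = (\<integral>\<^sup>+x. (SUP n. min (f x) (of_nat n)) \<partial>M)" by simp
  also have "\<dots> = (SUP n. \<integral>\<^sup>+x. min (f x) (of_nat n) \<partial>M)"
    by (rule nn_integral_monotone_convergence_SUP) (use inc in \<open>auto simp: incseq_Suc_iff le_fun_def\<close>)
  finally show ?thesis by simp
qed

lemma prekopa_leindler_real:
  fixes f g h :: "real \<Rightarrow> ennreal"
  assumes [measurable]: "f \<in> borel_measurable borel" "g \<in> borel_measurable borel" "h \<in> borel_measurable borel"
    and t: "0 < t" "t < 1"
    and h: "\<And>x y. geom_mean_le t (f x) (g y) (h ((1 - t) * x + t * y))"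
  shows "geom_mean_le t (\<integral>\<^sup>+x. f x \<partial>lborel) (\<integral>\<^sup>+x. g x \<partial>lborel) (\<integral>\<^sup>+x. h x \<partial>lborel)"
proof (rule geom_mean_leI)
  fix u v
  assume "ennreal (exp u) < (\<integral>\<^sup>+x. f x \<partial>lborel)" and "ennreal (exp v) < (\<integral>\<^sup>+x. g x \<partial>lborel)"
  then have "ennreal (exp u) < (SUP n. \<integral>\<^sup>+x. min (f x) (of_nat n) \<partial>lborel)"
    "ennreal (exp v) < (SUP n. \<integral>\<^sup>+x. min (g x) (of_nat n) \<partial>lborel)"
    by (simp_all add: nn_integral_truncate)
  then obtain m n where mn: "ennreal (exp u) < (\<integral>\<^sup>+x. min (f x) (of_nat m) \<partial>lborel)"
    "ennreal (exp v) < (\<integral>\<^sup>+x. min (g x) (of_nat n) \<partial>lborel)"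
    unfolding less_SUP_iff by blast
  have fin: "(SUP x. min (k x) (of_nat n)) < \<infinity>" for k :: "real \<Rightarrow> ennreal" and n
    by (rule le_less_trans[of _ "of_nat n"]) (auto intro!: SUP_least simp: of_nat_less_top)
  have "geom_mean_le t (\<integral>\<^sup>+x. min (f x) (of_nat m) \<partial>lborel) (\<integral>\<^sup>+x. min (g x) (of_nat n) \<partial>lborel) (\<integral>\<^sup>+x. h x \<partial>lborel)"
    by (rule prekopa_leindler_real_bounded[OF _ _ _ t fin fin])
      (use h in \<open>auto simp: geom_mean_le_def\<close>)
  from geom_mean_leD[OF this mn] show "ennreal (exp ((1 - t) * u + t * v)) \<le> (\<integral>\<^sup>+x. h x \<partial>lborel)" .
qed

text \<open>
  Induction on the dimension: for fixed remaining coordinates the one-dimensional inequality says that the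
  partial integrals satisfy the same hypothesis.
\<close>
lemma prekopa_leindler_PiM:
  fixes f g h :: "('i \<Rightarrow> real) \<Rightarrow> ennreal"
  assumes "finite I" and t: "0 < t" "t < 1"
    and "f \<in> borel_measurable (PiM I (\<lambda>_. lborel))" "g \<in> borel_measurable (PiM I (\<lambda>_. lborel))"
      "h \<in> borel_measurable (PiM I (\<lambda>_. lborel))"
    and "\<And>x y z. x \<in> extensional I \<Longrightarrow> y \<in> extensional I \<Longrightarrow> z \<in> extensional I \<Longrightarrow>
      (\<And>i. i \<in> I \<Longrightarrow> z i = (1 - t) * x i + t * y i) \<Longrightarrow> geom_mean_le t (f x) (g y) (h z)"
  shows "geom_mean_le t (\<integral>\<^sup>+x. f x \<partial>PiM I (\<lambda>_. lborel)) (\<integral>\<^sup>+x. g x \<partial>PiM I (\<lambda>_. lborel))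
           (\<integral>\<^sup>+x. h x \<partial>PiM I (\<lambda>_. lborel))"
  using assms(1,4-)
proof (induction I arbitrary: f g h rule: finite_induct)
  case empty
  interpret product_sigma_finite "\<lambda>_::'i. lborel :: real measure"
    by (simp add: product_sigma_finite_def lborel.sigma_finite_measure_axioms)
  show ?case using empty by (simp add: nn_integral_empty)
next
  case (insert i I)
  interpret product_sigma_finite "\<lambda>_::'i. lborel :: real measure"
    by (simp add: product_sigma_finite_def lborel.sigma_finite_measure_axioms)
  note [measurable] = insert.prems(1-3)
  show ?case
    unfolding product_nn_integral_insert[OF insert.hyps(1,2) insert.prems(1)]
      product_nn_integral_insert[OF insert.hyps(1,2) insert.prems(2)]
      product_nn_integral_insert[OF insert.hyps(1,2) insert.prems(3)]
  proof (rule insert.IH)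
    fix x y z :: "'i \<Rightarrow> real"
    assume ext: "x \<in> extensional I" "y \<in> extensional I" "z \<in> extensional I"
      and z: "\<And>i. i \<in> I \<Longrightarrow> z i = (1 - t) * x i + t * y i"
    have meas: "(\<lambda>a. k (w(i := a))) \<in> borel_measurable borel"
      if "w \<in> extensional I" and [measurable]: "k \<in> borel_measurable (PiM (insert i I) (\<lambda>_. lborel))"
      for w :: "'i \<Rightarrow> real" and k :: "_ \<Rightarrow> ennreal"
    proof -
      have "w \<in> space (PiM I (\<lambda>_. lborel :: real measure))" using that by (simp add: space_PiM PiE_def)
      then have "(\<lambda>a. w(i := a)) \<in> measurable lborel (PiM (insert i I) (\<lambda>_. lborel))" by measurable
      then have "(\<lambda>a. k (w(i := a))) \<in> borel_measurable lborel" by measurable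
      then show ?thesis by simp
    qed
    show "geom_mean_le t (\<integral>\<^sup>+a. f (x(i := a)) \<partial>lborel) (\<integral>\<^sup>+a. g (y(i := a)) \<partial>lborel) (\<integral>\<^sup>+a. h (z(i := a)) \<partial>lborel)"
    proof (rule prekopa_leindler_real[OF _ _ _ t])
      fix a b :: real
      show "geom_mean_le t (f (x(i := a))) (g (y(i := b))) (h (z(i := (1 - t) * a + t * b)))"
        by (rule insert.prems(4)) (use ext z insert.hyps(2) in \<open>auto simp: extensional_def\<close>)
    qed (use meas ext insert.prems in auto)
  qed measurable
qed

lemma prekopa_leindler_lborel:
  fixes f g h :: "'a::euclidean_space \<Rightarrow> ennreal"
  assumes t: "0 < t" "t < 1"
    and [measurable]: "f \<in> borel_measurable borel" "g \<in> borel_measurable borel" "h \<in> borel_measurable borel"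
    and h: "\<And>x y. geom_mean_le t (f x) (g y) (h ((1 - t) *\<^sub>R x + t *\<^sub>R y))"
  shows "geom_mean_le t (\<integral>\<^sup>+x. f x \<partial>lborel) (\<integral>\<^sup>+x. g x \<partial>lborel) (\<integral>\<^sup>+x. h x \<partial>lborel)"
proof -
  define S :: "('a \<Rightarrow> real) \<Rightarrow> 'a" where "S x = (\<Sum>b\<in>Basis. x b *\<^sub>R b)" for x
  have [measurable]: "S \<in> measurable (PiM Basis (\<lambda>_. lborel)) borel" unfolding S_def by measurable
  have eq: "(\<integral>\<^sup>+x. k x \<partial>lborel) = (\<integral>\<^sup>+x. k (S x) \<partial>PiM Basis (\<lambda>_. lborel))"
    if "k \<in> borel_measurable borel" for k :: "'a \<Rightarrow> ennreal"
    using that by (subst lborel_eq) (simp add: nn_integral_distr S_def[abs_def, symmetric])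
  show ?thesis
    unfolding eq[OF assms(3)] eq[OF assms(4)] eq[OF assms(5)]
  proof (rule prekopa_leindler_PiM[OF _ t])
    fix x y z :: "'a \<Rightarrow> real"
    assume "\<And>b. b \<in> Basis \<Longrightarrow> z b = (1 - t) * x b + t * y b"
    then have "S z = (1 - t) *\<^sub>R S x + t *\<^sub>R S y"
      by (simp add: S_def scaleR_sum_right scaleR_add_left sum.distrib)
    then show "geom_mean_le t (f (S x)) (g (S y)) (h (S z))" using h by simp
  qed auto
qed

section \<open>Extended exponentials, Legendre transforms and semicontinuity\<close>

lemma exp_ext_simps [simp]:
  "exp_ext (ereal r) = ennreal (exp r)" "exp_ext \<infinity> = \<infinity>" "exp_ext (-\<infinity>) = 0"
  by (simp_all add: exp_ext_def)

lemma ennreal_exp_less_exp_ext_iff: "ennreal (exp u) < exp_ext z \<longleftrightarrow> ereal u < z"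
  by (cases z) (auto simp: ennreal_less_iff)

lemma exp_ext_less_ennreal_exp_iff: "exp_ext z < ennreal (exp u) \<longleftrightarrow> z < ereal u"
  by (cases z) (auto simp: ennreal_less_iff)

lemma exp_ext_mono: "w \<le> z \<Longrightarrow> exp_ext w \<le> exp_ext z"
  by (cases w; cases z) (auto intro: ennreal_leI)

lemma exp_ext_measurable [measurable]: "exp_ext \<in> borel_measurable borel"
proof (rule borel_measurableI_greater)
  fix y :: ennreal
  have "{x. y < exp_ext x} = (if y = top then {} else if y = 0 then {-\<infinity><..} else {ereal (ln (enn2real y)) <..})"
  proof (cases "y = top \<or> y = 0")
    case True
    then show ?thesis
    proof
      assume "y = 0"
      moreover have "0 < exp_ext x \<longleftrightarrow> -\<infinity> < x" for x by (cases x) auto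
      ultimately show ?thesis by auto
    qed (auto simp: top_unique)
  next
    case False
    then obtain r where r: "y = ennreal r" "0 < r"
      by (cases y) (auto simp: less_le)
    then have "y = ennreal (exp (ln r))" by simp
    then have "{x. y < exp_ext x} = {ereal (ln r) <..}" using ennreal_exp_less_exp_ext_iff[of "ln r"] by auto
    then show ?thesis using False r by simp
  qed
  then show "{x \<in> space borel. y < exp_ext x} \<in> sets borel" by simp
qed

lemma open_superlevel_imp_borel:
  fixes f :: "'a::topological_space \<Rightarrow> ereal"
  assumes "\<And>a. open {x. a < f x}"
  shows "f \<in> borel_measurable borel"
  by (rule borel_measurableI_greater) (use assms in auto)

lemma lower_semicontinuous_imp_borel:
  fixes f :: "'a::topological_space \<Rightarrow> ereal"
  assumes "lower_semicontinuous f"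
  shows "f \<in> borel_measurable borel"
proof (rule open_superlevel_imp_borel)
  fix a
  show "open {x. a < f x}"
  proof (subst open_subopen, rule ballI)
    fix x assume "x \<in> {x. a < f x}"
    then have "a < f x" by simp
    also have "f x \<le> Liminf (at x) f" using assms by (simp add: lower_semicontinuous_def)
    finally have "eventually (\<lambda>z. a < f z) (at x)" by (rule less_LiminfD)
    then obtain T where "open T" "x \<in> T" "\<And>z. z \<in> T \<Longrightarrow> z \<noteq> x \<Longrightarrow> a < f z"
      unfolding eventually_at_topological by blast
    then show "\<exists>T. open T \<and> x \<in> T \<and> T \<subseteq> {x. a < f x}"
      using \<open>a < f x\<close> by (intro exI[of _ T]) blast
  qed
qed

text \<open>
  A supremum of continuous functions of \<open>y\<close> is lower semicontinuous.
\<close>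
lemma borel_measurable_legendre:
  fixes f :: "'a::euclidean_space \<Rightarrow> ereal"
  shows "legendre f \<in> borel_measurable borel"
proof (rule open_superlevel_imp_borel)
  fix a
  have "open {y. a < ereal (x \<bullet> y) - f x}" for x
  proof (cases "f x")
    case (real r)
    have "open ((\<lambda>y. ereal (x \<bullet> y - r)) -` {a<..})"
      by (intro open_vimage continuous_intros)
    then show ?thesis using real by (simp add: vimage_def)
  qed (auto simp: not_le)
  then have "open (\<Union>x. {y. a < ereal (x \<bullet> y) - f x})" by blast
  also have "(\<Union>x. {y. a < ereal (x \<bullet> y) - f x}) = {y. a < legendre f y}"
    by (auto simp: legendre_def less_SUP_iff)
  finally show "open {y. a < legendre f y}" .
qed

section \<open>Log-concave densities\<close>

text \<open>
  The potential is a real convex function \<open>W\<close> on an open convex set \<open>U\<close>, and is \<open>\<infinity>\<close> outside. Unlike a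
  general extended convex potential this always gives a Borel density.
\<close>
definition log_concave_density :: "'a set \<Rightarrow> ('a::euclidean_space \<Rightarrow> real) \<Rightarrow> 'a \<Rightarrow> ennreal" where
  "log_concave_density U W y = indicator U y * ennreal (exp (- W y))"

lemma borel_measurable_log_concave_density:
  assumes "open U" "convex_on U W"
  shows "log_concave_density U W \<in> borel_measurable borel"
proof -
  have "(\<lambda>y. if y \<in> U then W y else 0) \<in> borel_measurable borel"
    using assms by (intro borel_measurable_continuous_on_if continuous_intros convex_on_continuous) auto
  then have "(\<lambda>y. indicator U y * ennreal (exp (- (if y \<in> U then W y else 0)))) \<in> borel_measurable borel"
    using assms(1) by (auto intro!: borel_measurable_times_ennreal borel_measurable_indicator)
  also have "(\<lambda>y. indicator U y * ennreal (exp (- (if y \<in> U then W y else 0)))) = log_concave_density U W"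
    by (auto simp: log_concave_density_def fun_eq_iff indicator_def)
  finally show ?thesis .
qed

text \<open>
  The potential may be replaced by \<open>\<infinity>\<close> outside the interior of its domain, since the frontier of a convex
  set is a null set.
\<close>
lemma log_concave_measure_eq_density:
  fixes m :: "'a::euclidean_space measure"
  assumes "log_concave_measure m"
  obtains U W where "open U" "convex U" "convex_on U W" "m = density lborel (log_concave_density U W)"
proof -
  obtain V where sets: "sets m = sets borel" and V: "ext_convex V"
    and m: "\<And>A. A \<in> sets borel \<Longrightarrow> emeasure m A = (\<integral>\<^sup>+x\<in>A. exp_ext (- V x) \<partial>lebesgue)"
    using assms unfolding log_concave_measure_def by blast
  define D where "D = {x. V x \<noteq> \<infinity>}"
  define W where "W x = real_of_ereal (V x)" for x
  define U where "U = interior D"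
  have VW: "V x = ereal (W x)" if "x \<in> D" for x
    using that V unfolding D_def W_def ext_convex_def by (cases "V x") auto
  have conv: "V ((1 - t) *\<^sub>R x + t *\<^sub>R y) \<le> ereal ((1 - t) * W x + t * W y)"
    if "x \<in> D" "y \<in> D" "0 < t" "t < 1" for x y t
  proof -
    have "V ((1 - t) *\<^sub>R x + t *\<^sub>R y) \<le> ereal (1 - t) * V x + ereal t * V y"
      using V that unfolding ext_convex_def by blast
    then show ?thesis using that by (simp add: VW)
  qed
  have D: "convex D"
    unfolding convex_alt
  proof (intro ballI allI impI)
    fix x y and t :: real assume *: "x \<in> D" "y \<in> D" "0 \<le> t \<and> t \<le> 1"
    consider "t = 0" | "t = 1" | "0 < t" "t < 1" using * by linarith
    then show "(1 - t) *\<^sub>R x + t *\<^sub>R y \<in> D"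
      by cases (use * conv[of x y t] in \<open>auto simp: D_def\<close>)
  qed
  have UD: "U \<subseteq> D" by (simp add: U_def interior_subset)
  have U: "open U" "convex U" using D by (auto simp: U_def convex_interior)
  have W: "convex_on U W"
  proof (rule convex_onI)
    fix t x y assume *: "0 < t" "t < (1::real)" "x \<in> U" "y \<in> U"
    then have "(1 - t) *\<^sub>R x + t *\<^sub>R y \<in> U" using convexD_alt[OF U(2), of x y t] by auto
    then have "V ((1 - t) *\<^sub>R x + t *\<^sub>R y) = ereal (W ((1 - t) *\<^sub>R x + t *\<^sub>R y))" using UD VW by blast
    then show "W ((1 - t) *\<^sub>R x + t *\<^sub>R y) \<le> (1 - t) * W x + t * W y"
      using conv[of x y t] * UD by auto
  qed (rule U)
  have "frontier D \<in> null_sets lebesgue"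
    using negligible_convex_frontier[OF D] by (simp add: negligible_iff_null_sets)
  then have "AE y in lebesgue. y \<notin> frontier D" by (rule AE_not_in)
  then have ae: "AE y in lebesgue. exp_ext (- V y) = log_concave_density U W y"
  proof eventually_elim
    case (elim y)
    show ?case
    proof (cases "y \<in> U")
      case True
      then show ?thesis using UD by (auto simp: log_concave_density_def VW)
    next
      case False
      with elim have "y \<notin> D" using closure_subset by (auto simp: frontier_def U_def)
      then show ?thesis using False by (simp add: log_concave_density_def D_def)
    qed
  qed
  have [measurable]: "log_concave_density U W \<in> borel_measurable borel"
    by (rule borel_measurable_log_concave_density[OF U(1) W])
  have "m = density lborel (log_concave_density U W)"
  proof (rule measure_eqI)
    fix A assume "A \<in> sets m"
    then have A: "A \<in> sets borel" by (simp add: sets)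
    have "emeasure m A = (\<integral>\<^sup>+x\<in>A. log_concave_density U W x \<partial>lebesgue)"
      unfolding m[OF A] by (rule nn_integral_cong_AE) (use ae in eventually_elim, simp)
    also have "\<dots> = emeasure (density lborel (log_concave_density U W)) A"
      using A by (simp add: nn_integral_completion emeasure_density)
    finally show "emeasure m A = emeasure (density lborel (log_concave_density U W)) A" .
  qed (simp add: sets)
  with U W show ?thesis by (rule that)
qed

section \<open>Finite maxima of affine functions\<close>

definition affine_max :: "(nat \<Rightarrow> 'a::real_inner) \<Rightarrow> (nat \<Rightarrow> real) \<Rightarrow> nat \<Rightarrow> 'a \<Rightarrow> real" where
  "affine_max x c N y = (MAX i\<in>{..N}. x i \<bullet> y - c i)"

definition affine_sup :: "(nat \<Rightarrow> 'a::real_inner) \<Rightarrow> (nat \<Rightarrow> real) \<Rightarrow> 'a \<Rightarrow> ereal" where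
  "affine_sup x c y = (SUP i. ereal (x i \<bullet> y - c i))"

lemma affine_max_ge: "i \<le> N \<Longrightarrow> x i \<bullet> y - c i \<le> affine_max x c N y"
  unfolding affine_max_def by (rule Max_ge) auto

lemma affine_max_le_iff: "affine_max x c N y \<le> b \<longleftrightarrow> (\<forall>i\<le>N. x i \<bullet> y - c i \<le> b)"
  unfolding affine_max_def by (subst Max_le_iff) auto

lemma affine_max_attained: "\<exists>i\<le>N. affine_max x c N y = x i \<bullet> y - c i"
proof -
  have "affine_max x c N y \<in> (\<lambda>i. x i \<bullet> y - c i) ` {..N}"
    unfolding affine_max_def by (rule Max_in) auto
  then show ?thesis by auto
qed

lemma affine_max_le_affine_sup: "ereal (affine_max x c N y) \<le> affine_sup x c y"
proof -
  obtain i where "affine_max x c N y = x i \<bullet> y - c i" using affine_max_attained[of N x c y] by auto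
  then show ?thesis unfolding affine_sup_def by (auto intro: SUP_upper)
qed

lemma borel_measurable_affine_max [measurable]:
  "affine_max x c N \<in> borel_measurable (borel :: 'a::euclidean_space measure)"
  unfolding affine_max_def[abs_def] by (intro borel_measurable_Max) measurable

text \<open>
  The graph of \<open>f\<close> over its effective domain is separable, and \<open>(x, c) \<mapsto> x \<bullet> y - c\<close> is continuous, so a
  countable dense subset of the graph gives the same supremum for every \<open>y\<close>.
\<close>
lemma legendre_eq_affine_sup:
  fixes f :: "'a::euclidean_space \<Rightarrow> ereal"
  assumes f: "\<And>x. f x \<noteq> -\<infinity>" and "\<exists>x. f x \<noteq> \<infinity>"
  obtains x c where "\<And>i. f (x i) = ereal (c i)" "\<And>y. legendre f y = affine_sup x c y"
proof -
  define S where "S = {p. f (fst p) = ereal (snd p)}"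
  have S: "(z, real_of_ereal (f z)) \<in> S" if "f z \<noteq> \<infinity>" for z
    using f[of z] that by (cases "f z") (auto simp: S_def)
  obtain T where T: "countable T" "T \<subseteq> S" "S \<subseteq> closure T" by (rule separable)
  have "T \<noteq> {}" using assms(2) S T(3) by auto
  define x where "x i = fst (from_nat_into T i)" for i
  define c where "c i = snd (from_nat_into T i)" for i
  have T_range: "\<exists>i. p = (x i, c i)" if "p \<in> T" for p
    using from_nat_into_surj[OF T(1) that] by (auto simp: x_def c_def)
  have fx: "f (x i) = ereal (c i)" for i
    using from_nat_into[OF \<open>T \<noteq> {}\<close>, of i] T(2) by (auto simp: S_def x_def c_def)
  have "legendre f y = affine_sup x c y" for y
  proof (rule antisym)
    show "affine_sup x c y \<le> legendre f y"
      unfolding affine_sup_def legendre_def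
      by (rule SUP_least, rule SUP_upper2[of "x _"]) (auto simp: fx)
    show "legendre f y \<le> affine_sup x c y"
      unfolding legendre_def
    proof (rule SUP_least)
      fix z
      show "ereal (z \<bullet> y) - f z \<le> affine_sup x c y"
      proof (cases "f z = \<infinity>")
        case False
        define r where "r = real_of_ereal (f z)"
        have fz: "f z = ereal r" using f[of z] False by (cases "f z") (auto simp: r_def)
        have cl: "(z, r) \<in> closure T" using S[OF False] T(3) by (auto simp: r_def)
        have "ereal (z \<bullet> y - r) \<le> affine_sup x c y"
        proof (rule ccontr)
          assume "\<not> ?thesis"
          then have less: "affine_sup x c y < ereal (z \<bullet> y - r)" by simp
          define h where "h p = ereal (fst p \<bullet> y - snd p)" for p :: "'a \<times> real"
          have "open (h -` {affine_sup x c y<..})"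
            unfolding h_def by (intro open_vimage continuous_intros)
          moreover have "(z, r) \<in> h -` {affine_sup x c y<..} \<inter> closure T" using cl less by (auto simp: h_def)
          ultimately have "h -` {affine_sup x c y<..} \<inter> T \<noteq> {}" using open_Int_closure_eq_empty by blast
          then obtain i where "affine_sup x c y < ereal (x i \<bullet> y - c i)" using T_range by (fastforce simp: h_def)
          moreover have "ereal (x i \<bullet> y - c i) \<le> affine_sup x c y" unfolding affine_sup_def by (rule SUP_upper) simp
          ultimately show False by simp
        qed
        then show ?thesis by (simp add: fz)
      qed simp
    qed
  qed
  with fx show ?thesis by (rule that)
qed

lemma INF_exp_affine_max:
  "(INF k. ennreal (exp (- affine_max x c (M + k) y))) = exp_ext (- affine_sup x c y)"
proof (rule antisym)
  show "exp_ext (- affine_sup x c y) \<le> (INF k. ennreal (exp (- affine_max x c (M + k) y)))"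
  proof (rule INF_greatest)
    fix k
    have "- affine_sup x c y \<le> - ereal (affine_max x c (M + k) y)"
      using affine_max_le_affine_sup[of x c "M + k" y] by (simp only: ereal_minus_le_minus)
    from exp_ext_mono[OF this]
    show "exp_ext (- affine_sup x c y) \<le> ennreal (exp (- affine_max x c (M + k) y))" by simp
  qed
  show "(INF k. ennreal (exp (- affine_max x c (M + k) y))) \<le> exp_ext (- affine_sup x c y)"
  proof (rule ccontr)
    assume "\<not> ?thesis"
    then obtain a where a: "exp_ext (- affine_sup x c y) < a" "a < (INF k. ennreal (exp (- affine_max x c (M + k) y)))"
      using dense[of "exp_ext (- affine_sup x c y)"] by (auto simp: not_le)
    have "a < top" using a(2) by (rule less_le_trans) simp
    then obtain r where r: "a = ennreal r" "0 \<le> r" unfolding less_top_ennreal by blast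
    have "0 < a" using a(1) by (rule le_less_trans[OF zero_le])
    then have "0 < r" using r by simp
    then have a_exp: "a = ennreal (exp (ln r))" using r by simp
    have "- affine_sup x c y < ereal (ln r)"
      using a(1) unfolding a_exp by (simp only: exp_ext_less_ennreal_exp_iff)
    then have "ereal (- ln r) < affine_sup x c y" by (simp add: ereal_uminus_less_reorder)
    then obtain i where i: "- ln r < x i \<bullet> y - c i" by (auto simp: affine_sup_def less_SUP_iff)
    also have "\<dots> \<le> affine_max x c (M + i) y" by (rule affine_max_ge) simp
    finally have "exp (- affine_max x c (M + i) y) < exp (ln r)" by simp
    then have "ennreal (exp (- affine_max x c (M + i) y)) < a" unfolding a_exp by (simp add: ennreal_less_iff)
    moreover have "a < ennreal (exp (- affine_max x c (M + i) y))"
      using a(2) by (rule less_le_trans) (rule INF_lower, simp)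
    ultimately show False by simp
  qed
qed

lemma affine_max_mono: "M \<le> N \<Longrightarrow> affine_max x c M y \<le> affine_max x c N y"
  by (auto simp: affine_max_le_iff intro: affine_max_ge)

text \<open>
  For a decreasing sequence, monotone convergence requires one finite integral, here the \<open>M\<close>-th.
\<close>
lemma affine_max_integral_tendsto:
  fixes m :: "'a::euclidean_space measure"
  assumes sets[measurable_cong]: "sets m = sets borel" and fin: "(\<integral>\<^sup>+y. ennreal (exp (- affine_max x c M y)) \<partial>m) < \<infinity>"
  shows "(\<lambda>k. \<integral>\<^sup>+y. ennreal (exp (- affine_max x c (M + k) y)) \<partial>m)
           \<longlonglongrightarrow> (\<integral>\<^sup>+y. exp_ext (- affine_sup x c y) \<partial>m)"
proof -
  define F where "F k y = ennreal (exp (- affine_max x c (M + k) y))" for k y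
  have dec: "decseq F"
    by (auto simp: monotone_def le_fun_def F_def intro!: ennreal_leI affine_max_mono)
  have meas: "F k \<in> borel_measurable m" for k unfolding F_def by measurable
  have "(\<integral>\<^sup>+y. (INF k. F k y) \<partial>m) = (INF k. integral\<^sup>N m (F k))"
    by (rule nn_integral_monotone_convergence_INF_decseq[OF dec meas, of 0]) (use fin in \<open>simp add: F_def\<close>)
  then have "(\<integral>\<^sup>+y. exp_ext (- affine_sup x c y) \<partial>m) = (INF k. integral\<^sup>N m (F k))"
    by (simp add: F_def INF_exp_affine_max)
  moreover have "decseq (\<lambda>k. integral\<^sup>N m (F k))"
    using dec by (auto simp: monotone_def le_fun_def intro!: nn_integral_mono)
  ultimately have "(\<lambda>k. integral\<^sup>N m (F k)) \<longlonglongrightarrow> (\<integral>\<^sup>+y. exp_ext (- affine_sup x c y) \<partial>m)"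
    using LIMSEQ_INF[of "\<lambda>k. integral\<^sup>N m (F k)"] by simp
  then show ?thesis unfolding F_def .
qed

section \<open>Coercivity of integrable log-concave densities\<close>

text \<open>
  If the set contains a ball and a point \<open>y\<close> at large distance \<open>d\<close>, then it contains balls of half the radius
  around all points in the first half of the segment to \<open>y\<close>, and about \<open>d / (2 r)\<close> of these are disjoint.
\<close>
lemma convex_finite_measure_imp_bounded:
  fixes A :: "'a::euclidean_space set"
  assumes "convex A" and r: "0 < r" and ball: "ball y0 r \<subseteq> A"
    and A: "A \<in> sets borel" "emeasure lborel A < \<infinity>"
  shows "bounded A"
proof (rule ccontr)
  assume unb: "\<not> bounded A"
  define b where "b = unit_ball_vol (DIM('a)) * (r / 2) ^ DIM('a)"
  have b: "0 < b" using r by (simp add: b_def unit_ball_vol_pos)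
  obtain a where a: "0 \<le> a" "emeasure lborel A = ennreal a"
    using A(2) unfolding infinity_ennreal_def less_top_ennreal by blast
  (* As b is the volume of a ball of radius r / 2, N disjoint such balls outweigh A. *)
  obtain N :: nat where N: "a < real N * b" using reals_Archimedean3[OF b] by blast
  have "\<exists>y\<in>A. 2 * real N * r + 1 < dist y0 y"
  proof (rule ccontr)
    assume "\<not> (\<exists>y\<in>A. 2 * real N * r + 1 < dist y0 y)"
    then have "A \<subseteq> cball y0 (2 * real N * r + 1)" by (auto simp: not_less)
    with unb show False using bounded_cball bounded_subset by blast
  qed
  then obtain y where y: "y \<in> A" "2 * real N * r + 1 < norm (y - y0)"
    by (auto simp: dist_norm norm_minus_commute)
  define d where "d = norm (y - y0)"
  have d: "0 < d" "2 * real N * r < d"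
    using y(2) r mult_nonneg_nonneg[of "2 * real N" r] unfolding d_def by linarith+
  define p where "p j = y0 + (real j * r / d) *\<^sub>R (y - y0)" for j :: nat
  have sub: "ball (p j) (r / 2) \<subseteq> A" if "j < N" for j
  proof
    fix q assume q: "q \<in> ball (p j) (r / 2)"
    define s where "s = real j * r / d"
    have "2 * real j * r \<le> 2 * real N * r" using that r by simp
    then have "2 * real j * r \<le> d" using d(2) by linarith
    then have s: "0 \<le> s" "s \<le> 1 / 2" using d(1) r unfolding s_def by (auto simp: field_simps)
    define q' where "q' = y0 + (1 / (1 - s)) *\<^sub>R (q - p j)"
    have "norm (q' - y0) = norm (q - p j) / (1 - s)" using s by (simp add: q'_def)
    also have "\<dots> \<le> norm (q - p j) / (1 / 2)" using s by (intro divide_left_mono) auto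
    also have "\<dots> < r" using q by (simp add: dist_norm norm_minus_commute)
    finally have "q' \<in> A" using ball by (auto simp: dist_norm norm_minus_commute)
    then have "(1 - s) *\<^sub>R q' + s *\<^sub>R y \<in> A" using s y(1) \<open>convex A\<close> by (auto simp: convex_alt)
    also have "(1 - s) *\<^sub>R q' + s *\<^sub>R y = (1 - s) *\<^sub>R y0 + (q - p j) + s *\<^sub>R y"
      using s by (simp add: q'_def scaleR_add_right)
    also have "\<dots> = q"
    proof -
      have "p j = y0 + s *\<^sub>R (y - y0)" by (simp add: p_def s_def)
      then show ?thesis by (simp add: algebra_simps)
    qed
    finally show "q \<in> A" .
  qed
  have disj: "ball (p i) (r / 2) \<inter> ball (p j) (r / 2) = {}" if "i \<noteq> j" for i j
  proof -
    have "p i - p j = ((real i - real j) * r / d) *\<^sub>R (y - y0)"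
      by (simp add: p_def algebra_simps diff_divide_distrib)
    then have "dist (p i) (p j) = \<bar>real i - real j\<bar> * r"
      using d r by (simp add: dist_norm d_def[symmetric] abs_mult)
    moreover have "1 \<le> \<bar>real i - real j\<bar>" using that by linarith
    ultimately have "r \<le> dist (p i) (p j)" using r by simp
    then show ?thesis by (intro disjoint_ballI) auto
  qed
  have "ennreal (real N * b) = (\<Sum>j<N. emeasure lborel (ball (p j) (r / 2)))"
    using r b by (simp add: emeasure_ball b_def[symmetric] ennreal_mult ennreal_of_nat_eq_real_of_nat)
  also have "\<dots> = emeasure lborel (\<Union>j<N. ball (p j) (r / 2))"
    by (rule sum_emeasure) (auto simp: disjoint_family_on_def disj)
  also have "\<dots> \<le> emeasure lborel A"
    by (rule emeasure_mono) (use sub A in auto)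
  finally show False using a N b by (simp add: ennreal_le_iff)
qed

lemma power_le_fact_mult_exp:
  fixes x :: real assumes "0 \<le> x"
  shows "x ^ n \<le> fact n * exp x"
proof -
  have "x ^ n /\<^sub>R fact n \<le> exp x"
    unfolding exp_def using sum_le_suminf[OF summable_exp_generic[of x], of "{n}"] assms by simp
  then show ?thesis by (simp add: field_simps)
qed

text \<open>
  Summing over the shells \<open>k \<le> |y - y0| \<le> k + 1\<close> leaves a series with terms of order \<open>(k + 1)\<^sup>n exp(-a k)\<close>,
  where \<open>n\<close> is the dimension; half of the exponent absorbs the polynomial factor.
\<close>
lemma nn_integral_exp_neg_norm_finite:
  fixes y0 :: "'a::euclidean_space"
  assumes a: "0 < a"
  shows "(\<integral>\<^sup>+y. ennreal (exp (- a * norm (y - y0))) \<partial>lborel) < \<infinity>"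
proof -
  define n where "n = DIM('a)"
  define s where "s k = exp (- a * real k) * (unit_ball_vol (real n) * real (Suc k) ^ n)" for k
  have s0: "0 \<le> s k" for k by (simp add: s_def unit_ball_vol_nonneg)
  have "ennreal (exp (- a * norm (y - y0)))
      \<le> (\<Sum>k. ennreal (exp (- a * real k)) * indicator (cball y0 (real (Suc k))) y)" for y
  proof -
    define k where "k = nat \<lfloor>norm (y - y0)\<rfloor>"
    have k: "real k \<le> norm (y - y0)" "norm (y - y0) \<le> real (Suc k)"
      unfolding k_def by (auto intro!: of_nat_floor) linarith
    have "ennreal (exp (- a * norm (y - y0))) \<le> (\<Sum>k\<in>{k}. ennreal (exp (- a * real k)) * indicator (cball y0 (real (Suc k))) y)"
      using k a by (auto simp: dist_norm norm_minus_commute indicator_def intro!: ennreal_leI)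
    also have "\<dots> \<le> (\<Sum>k. ennreal (exp (- a * real k)) * indicator (cball y0 (real (Suc k))) y)"
      by (rule sum_le_suminf) auto
    finally show ?thesis .
  qed
  then have "(\<integral>\<^sup>+y. ennreal (exp (- a * norm (y - y0))) \<partial>lborel)
      \<le> (\<integral>\<^sup>+y. (\<Sum>k. ennreal (exp (- a * real k)) * indicator (cball y0 (real (Suc k))) y) \<partial>lborel)"
    by (intro nn_integral_mono)
  also have "\<dots> = (\<Sum>k. \<integral>\<^sup>+y. ennreal (exp (- a * real k)) * indicator (cball y0 (real (Suc k))) y \<partial>lborel)"
    by (rule nn_integral_suminf) (auto intro!: borel_measurable_times_ennreal borel_measurable_indicator)
  also have "\<dots> = (\<Sum>k. ennreal (s k))"
    by (subst nn_integral_cmult_indicator)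
      (auto simp: emeasure_cball s_def n_def ennreal_mult[symmetric] unit_ball_vol_nonneg simp del: of_nat_Suc)
  also have "\<dots> < \<infinity>"
  proof -
    define b where "b = a / 2"
    have b: "0 < b" using a by (simp add: b_def)
    define C where "C = unit_ball_vol (real n) * fact n * exp b / b ^ n"
    have "summable s"
    proof (rule summable_comparison_test')
      show "summable (\<lambda>k. C * exp (- b) ^ k)"
        using b by (intro summable_mult summable_geometric) simp
      fix k :: nat
      have "b ^ n * real (Suc k) ^ n \<le> fact n * exp (b * real (Suc k))"
        using power_le_fact_mult_exp[of "b * real (Suc k)" n] b by (simp add: power_mult_distrib)
      then have "real (Suc k) ^ n \<le> fact n * exp (b * real (Suc k)) / b ^ n"
        using b by (simp add: field_simps)
      then have "s k \<le> exp (- a * real k) * (unit_ball_vol (real n) * (fact n * exp (b * real (Suc k)) / b ^ n))"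
        unfolding s_def by (intro mult_left_mono) (auto simp: unit_ball_vol_nonneg)
      also have "\<dots> = unit_ball_vol (real n) * fact n / b ^ n * (exp (- a * real k) * exp (b * real (Suc k)))"
        by simp
      also have "exp (- a * real k) * exp (b * real (Suc k)) = exp b * exp (- b) ^ k"
        by (simp add: exp_add[symmetric] exp_of_nat_mult[symmetric] b_def field_simps)
      also have "unit_ball_vol (real n) * fact n / b ^ n * (exp b * exp (- b) ^ k) = C * exp (- b) ^ k"
        by (simp add: C_def)
      finally show "norm (s k) \<le> C * exp (- b) ^ k" using s0 by simp
    qed
    then show ?thesis using s0 by (simp add: suminf_ennreal2)
  qed
  finally show ?thesis .
qed

text \<open>
  Difference quotients of a convex function increase along a segment.
\<close>
lemma convex_on_ray_growth:
  assumes g: "convex_on U g" and y: "y \<in> U" "y0 \<in> U" and s: "0 < s" "s \<le> 1"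
    and k: "g y0 \<le> k" and "k + 1 < g (y0 + s *\<^sub>R (y - y0))"
  shows "k + 1 / s \<le> g y"
proof -
  have "g ((1 - s) *\<^sub>R y0 + s *\<^sub>R y) \<le> (1 - s) * g y0 + s * g y"
    using s y by (intro convex_onD[OF g]) auto
  also have "(1 - s) *\<^sub>R y0 + s *\<^sub>R y = y0 + s *\<^sub>R (y - y0)" by (simp add: algebra_simps)
  finally have "k + 1 < (1 - s) * g y0 + s * g y" using assms by simp
  moreover have "(1 - s) * g y0 \<le> (1 - s) * k" using s k by (intro mult_left_mono) auto
  ultimately have "1 \<le> s * (g y - k)" by (simp add: algebra_simps)
  then show ?thesis using s by (simp add: field_simps)
qed

lemma convex_segment_point:
  assumes "convex U" "a \<in> U" "b \<in> U" "0 \<le> s" "s \<le> 1"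
  shows "a + s *\<^sub>R (b - a) \<in> U"
  using convexD_alt[OF assms] by (simp add: algebra_simps)

text \<open>
  Let \<open>k\<close> be a level at which the sublevel set of \<open>sup\<^sub>i a\<^sub>i + W\<close> has positive measure, where the \<open>a\<^sub>i\<close> are
  the affine functions, and \<open>y0\<close> an interior point of that set. The sublevel set at \<open>k + 1\<close> has finite measure,
  so it lies in a ball of radius \<open>R\<close> around \<open>y0\<close>.
  At the points of \<open>U\<close> on the sphere of radius \<open>R\<close> some \<open>a\<^sub>i + W\<close> exceeds \<open>k + 1\<close>, and by
  compactness the index can be bounded by some \<open>N\<close>. Convexity propagates this gain linearly along rays, so the
  density for the finite maximum decays exponentially.
\<close>
lemma affine_max_integrable:
  fixes x :: "nat \<Rightarrow> 'a::euclidean_space"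
  assumes U: "open U" "convex U" and W: "convex_on U W"
    and pos: "0 < (\<integral>\<^sup>+y. exp_ext (- affine_sup x c y) * log_concave_density U W y \<partial>lborel)"
    and fin: "(\<integral>\<^sup>+y. exp_ext (- affine_sup x c y) * log_concave_density U W y \<partial>lborel) < \<infinity>"
  shows "\<exists>N. (\<integral>\<^sup>+y. ennreal (exp (- affine_max x c N y)) * log_concave_density U W y \<partial>lborel) < \<infinity>"
proof -
  define g where "g i y = x i \<bullet> y - c i + W y" for i y
  have conv_g: "convex_on U (g i)" for i
  proof -
    have "convex_on U (\<lambda>y. x i \<bullet> y - c i)"
      using U(2) by (intro convex_onI) (auto simp: inner_add_right algebra_simps)
    from convex_on_add[OF this W] show ?thesis by (simp add: g_def[abs_def])
  qed
  have cont_g: "continuous_on U (g i)" for i by (rule convex_on_continuous[OF U(1) conv_g])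
  define S where "S k = {y\<in>U. \<forall>i. g i y \<le> k}" for k :: real
  have S_borel: "S k \<in> sets borel" for k
  proof -
    have "{y\<in>U. g i y \<le> k} \<in> sets borel" for i
    proof -
      have "open (U \<inter> g i -` {k<..})" by (rule continuous_open_preimage[OF cont_g U(1) open_greaterThan])
      then have "U - (U \<inter> g i -` {k<..}) \<in> sets borel" using U(1) by auto
      also have "U - (U \<inter> g i -` {k<..}) = {y\<in>U. g i y \<le> k}" by auto
      finally show ?thesis .
    qed
    then have "(\<Inter>i. {y\<in>U. g i y \<le> k}) \<in> sets borel" by auto
    also have "(\<Inter>i. {y\<in>U. g i y \<le> k}) = S k" by (auto simp: S_def)
    finally show ?thesis .
  qed
  have S_conv: "convex (S k)" for k
  proof -
    have "convex {y\<in>U. g i y \<le> k}" for i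
      unfolding convex_alt
    proof (safe)
      fix y z and t :: real assume *: "y \<in> U" "g i y \<le> k" "z \<in> U" "g i z \<le> k" "0 \<le> t" "t \<le> 1"
      then show "(1 - t) *\<^sub>R y + t *\<^sub>R z \<in> U" using U(2) unfolding convex_alt by blast
      have "g i ((1 - t) *\<^sub>R y + t *\<^sub>R z) \<le> (1 - t) * g i y + t * g i z"
        using * by (intro convex_onD[OF conv_g])
      also have "\<dots> \<le> (1 - t) * k + t * k" using * by (intro add_mono mult_left_mono) auto
      finally show "g i ((1 - t) *\<^sub>R y + t *\<^sub>R z) \<le> k" by (simp add: algebra_simps)
    qed
    then have "convex (\<Inter>i. {y\<in>U. g i y \<le> k})" by (intro convex_Inter) auto
    also have "(\<Inter>i. {y\<in>U. g i y \<le> k}) = S k" by (auto simp: S_def)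
    finally show ?thesis .
  qed
  have sup_le: "affine_sup x c y \<le> ereal (k - W y)" if "y \<in> S k" for y k
    using that unfolding affine_sup_def S_def g_def by (auto intro!: SUP_least simp: algebra_simps)
  have "\<exists>k::nat. emeasure lborel (S (real k)) \<noteq> 0"
  proof (rule ccontr)
    assume "\<not> ?thesis"
    then have "AE y in lborel. y \<notin> S (real k)" for k :: nat
      using S_borel by (intro AE_not_in) (auto simp: null_sets_def)
    then have "AE y in lborel. \<forall>k::nat. y \<notin> S (real k)" by (simp add: AE_all_countable)
    then have "AE y in lborel. exp_ext (- affine_sup x c y) * log_concave_density U W y = 0"
    proof eventually_elim
      case (elim y)
      show ?case
      proof (cases "y \<in> U")
        case True
        have "affine_sup x c y = \<infinity>"
        proof (rule ccontr)
          assume "affine_sup x c y \<noteq> \<infinity>"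
          then obtain r where r: "affine_sup x c y \<le> ereal r" by (cases "affine_sup x c y") auto
          obtain k :: nat where k: "r + W y \<le> real k" using real_arch_simple by blast
          have "x i \<bullet> y - c i \<le> r" for i
          proof -
            have "ereal (x i \<bullet> y - c i) \<le> affine_sup x c y" unfolding affine_sup_def by (rule SUP_upper) simp
            with r show ?thesis by (metis ereal_less_eq(3) order_trans)
          qed
          then have "g i y \<le> real k" for i using k unfolding g_def by (smt (verit))
          with True have "y \<in> S (real k)" by (simp add: S_def)
          with elim show False by blast
        qed
        then show ?thesis by simp
      qed (simp add: log_concave_density_def)
    qed
    then have "(\<integral>\<^sup>+y. exp_ext (- affine_sup x c y) * log_concave_density U W y \<partial>lborel) = (\<integral>\<^sup>+(y::'a). 0 \<partial>lborel)"
      by (rule nn_integral_cong_AE)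
    with pos show False by simp
  qed
  then obtain k :: nat where k: "emeasure lborel (S (real k)) \<noteq> 0" by blast
  have "interior (S (real k)) \<noteq> {}"
  proof
    assume "interior (S (real k)) = {}"
    then have "negligible (S (real k))" using negligible_convex_interior[OF S_conv] by blast
    then show False using k S_borel by (auto simp: negligible_iff_null_sets null_sets_def)
  qed
  then obtain y0 r where y0r: "0 < r" "ball y0 r \<subseteq> S (real k)"
    by (metis ex_in_conv mem_interior)
  have y0: "y0 \<in> U" "\<And>i. g i y0 \<le> k" using y0r unfolding S_def by (auto dest!: subsetD[of _ _ y0])
  have "emeasure lborel (S (real k + 1)) < \<infinity>"
  proof -
    have "ennreal (exp (- (real k + 1))) * emeasure lborel (S (real k + 1))
        = (\<integral>\<^sup>+y. ennreal (exp (- (real k + 1))) * indicator (S (real k + 1)) y \<partial>lborel)"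
      using S_borel by (subst nn_integral_cmult_indicator) auto
    also have "\<dots> \<le> (\<integral>\<^sup>+y. exp_ext (- affine_sup x c y) * log_concave_density U W y \<partial>lborel)"
    proof (rule nn_integral_mono)
      fix y :: 'a
      show "ennreal (exp (- (real k + 1))) * indicator (S (real k + 1)) y \<le> exp_ext (- affine_sup x c y) * log_concave_density U W y"
      proof (cases "y \<in> S (real k + 1)")
        case True
        have "ereal (W y - (real k + 1)) = - ereal (real k + 1 - W y)" by simp
        also have "\<dots> \<le> - affine_sup x c y" using sup_le[OF True] by (simp only: ereal_minus_le_minus)
        finally have "exp_ext (ereal (W y - (real k + 1))) \<le> exp_ext (- affine_sup x c y)" by (rule exp_ext_mono)
        then have "exp_ext (ereal (W y - (real k + 1))) * log_concave_density U W y \<le> exp_ext (- affine_sup x c y) * log_concave_density U W y"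
          by (rule mult_right_mono) simp
        moreover have "exp_ext (ereal (W y - (real k + 1))) * log_concave_density U W y = ennreal (exp (- (real k + 1)))"
          using True by (simp add: log_concave_density_def S_def ennreal_mult[symmetric] exp_add[symmetric])
        ultimately show ?thesis using True by simp
      qed simp
    qed
    also have "\<dots> < \<infinity>" by (rule fin)
    finally show ?thesis by (auto simp: ennreal_mult_less_top)
  qed
  moreover have "S (real k) \<subseteq> S (real k + 1)"
    by (auto simp: S_def intro: order_trans[of _ "real k"])
  then have "ball y0 r \<subseteq> S (real k + 1)" using y0r(2) by (rule order_trans[rotated])
  ultimately have "bounded (S (real k + 1))"
    using convex_finite_measure_imp_bounded[OF S_conv y0r(1) _ S_borel] by blast
  then obtain R where R: "0 < R" "S (real k + 1) \<subseteq> ball y0 R" 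
    using bounded_subset_ballD[of _ y0] by blast
  (* W need not be lower semicontinuous up to the boundary of U, so a point z of the sphere on the
     frontier of U cannot be covered directly. It is enough to control those points z whose reflection
     y0 + 2 (z - y0) lies in U; for z outside U this reflection avoids even the closure of U. *)
  have "\<exists>i G. open G \<and> z \<in> G \<and> (\<forall>z'\<in>G. y0 + 2 *\<^sub>R (z' - y0) \<in> U \<longrightarrow> real k + 1 < g i z')"
    if z: "z \<in> sphere y0 R" for z
  proof (cases "z \<in> U")
    case True
    have "z \<notin> S (real k + 1)" using R(2) z by auto
    then obtain i where "real k + 1 < g i z" using True by (auto simp: S_def not_le)
    moreover have "open (U \<inter> g i -` {real k + 1<..})" by (rule continuous_open_preimage[OF cont_g U(1) open_greaterThan])
    moreover have "z' \<in> U" if "y0 + 2 *\<^sub>R (z' - y0) \<in> U" for z'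
    proof -
      have "y0 + (1/2) *\<^sub>R ((y0 + 2 *\<^sub>R (z' - y0)) - y0) \<in> U"
        by (rule convex_segment_point[OF U(2) y0(1) that]) auto
      then show ?thesis by simp
    qed
    ultimately show ?thesis using True by (intro exI[of _ i] exI[of _ "U \<inter> g i -` {real k + 1<..}"]) auto
  next
    case False
    define e where "e z' = y0 + 2 *\<^sub>R (z' - y0)" for z'
    have "e z \<notin> closure U"
    proof
      assume "e z \<in> closure U"
      from mem_interior_closure_convex_shrink[OF U(2) _ this, of y0 "1/2"] y0(1) U(1)
      have "e z - (1/2) *\<^sub>R (e z - y0) \<in> U" by (simp add: interior_open)
      moreover have "e z - (1/2) *\<^sub>R (e z - y0) = z" by (simp add: e_def) (simp add: scaleR_2)
      ultimately show False using False by simp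
    qed
    moreover have "open (e -` (- closure U))"
      unfolding e_def by (intro open_vimage continuous_intros) auto
    moreover have "e z' \<notin> U" if "z' \<in> e -` (- closure U)" for z' using that closure_subset by auto
    ultimately show ?thesis unfolding e_def[symmetric] by (intro exI[of _ 0] exI[of _ "e -` (- closure U)"]) auto
  qed
  then obtain i G where iO: "\<And>z. z \<in> sphere y0 R \<Longrightarrow> open (G z) \<and> z \<in> G z \<and>
      (\<forall>z'\<in>G z. y0 + 2 *\<^sub>R (z' - y0) \<in> U \<longrightarrow> real k + 1 < g (i z) z')"
    by metis
  obtain C where C: "C \<subseteq> sphere y0 R" "finite C" "sphere y0 R \<subseteq> (\<Union>z\<in>C. G z)"
    by (rule compactE_image[of "sphere y0 R" "sphere y0 R" G]) (use iO in auto)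
  define N where "N = Max (insert 0 (i ` C))"
  have N: "i z \<le> N" if "z \<in> C" for z unfolding N_def using that C(2) by (intro Max_ge) auto
  have gN: "g j y \<le> affine_max x c N y + W y" if "j \<le> N" for j y
    using affine_max_ge[OF that, of x y c] by (simp add: g_def)
  (* Outside the doubled ball, the gain on the sphere is extended along the ray through y. *)
  have far: "real k + norm (y - y0) / R \<le> affine_max x c N y + W y" if y: "y \<in> U" "2 * R \<le> norm (y - y0)" for y
  proof -
    define s where "s = R / norm (y - y0)"
    have d0: "0 < norm (y - y0)" using y(2) R(1) by linarith
    then have s: "0 < s" "s \<le> 1 / 2" using y(2) R(1) by (auto simp: s_def divide_simps)
    define z' where "z' = y0 + s *\<^sub>R (y - y0)"
    have "z' \<in> sphere y0 R" using d0 R(1) by (simp add: z'_def dist_norm s_def)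
    then obtain z where z: "z \<in> C" "z' \<in> G z" using C(3) by blast
    have "y0 + (2 * s) *\<^sub>R (y - y0) \<in> U"
      by (rule convex_segment_point[OF U(2) y0(1) y(1)]) (use s in auto)
    also have "y0 + (2 * s) *\<^sub>R (y - y0) = y0 + 2 *\<^sub>R (z' - y0)" by (simp add: z'_def)
    finally have "real k + 1 < g (i z) z'" using iO z C(1) by blast
    then have "real k + 1 / s \<le> g (i z) y"
      using convex_on_ray_growth[OF conv_g y(1) y0(1) s(1), of "i z" "real k"] s y0(2) unfolding z'_def by auto
    then show ?thesis using gN[OF N[OF z(1)], of y] by (simp add: s_def)
  qed
  (* Inside the doubled ball, y0 lies between y and a point z of the ball around y0 on which g 0 is at
     most k. Since rho times 2 R is r / 2, the point z stays in that ball, and convexity bounds g 0 y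
     from below. *)
  define \<rho> where "\<rho> = r / (4 * R)"
  have \<rho>: "0 < \<rho>" using R y0r by (simp add: \<rho>_def)
  define B where "B = (real k - (1 + \<rho>) * g 0 y0) / \<rho>"
  have near: "- B \<le> affine_max x c N y + W y" if y: "y \<in> U" "norm (y - y0) \<le> 2 * R" for y
  proof -
    define z where "z = y0 - \<rho> *\<^sub>R (y - y0)"
    have "norm (z - y0) = \<rho> * norm (y - y0)" using \<rho> by (simp add: z_def)
    also have "\<dots> \<le> \<rho> * (2 * R)" using y \<rho> by (intro mult_left_mono) auto
    also have "\<dots> < r" using R y0r by (simp add: \<rho>_def)
    finally have "z \<in> S (real k)" using y0r(2) by (auto simp: dist_norm norm_minus_commute)
    then have z: "z \<in> U" "g 0 z \<le> k" by (auto simp: S_def)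
    define s where "s = \<rho> / (1 + \<rho>)"
    have s: "0 \<le> s" "s \<le> 1" "(1 + \<rho>) * s = \<rho>" "(1 + \<rho>) * (1 - s) = 1" using \<rho> by (auto simp: s_def field_simps)
    have "(1 + \<rho>) *\<^sub>R ((1 - s) *\<^sub>R z + s *\<^sub>R y) = z + \<rho> *\<^sub>R y"
      using s by (simp add: scaleR_add_right)
    also have "\<dots> = (1 + \<rho>) *\<^sub>R y0" by (simp add: z_def algebra_simps)
    finally have eq: "(1 - s) *\<^sub>R z + s *\<^sub>R y = y0" using \<rho> by simp
    have "g 0 y0 \<le> (1 - s) * g 0 z + s * g 0 y"
      using convex_onD[OF conv_g s(1,2) z(1) y(1), of 0] by (simp add: eq)
    then have "(1 + \<rho>) * g 0 y0 \<le> (1 + \<rho>) * ((1 - s) * g 0 z + s * g 0 y)"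
      using \<rho> by (intro mult_left_mono) auto
    also have "\<dots> = ((1 + \<rho>) * (1 - s)) * g 0 z + ((1 + \<rho>) * s) * g 0 y" by (simp only: distrib_left mult.assoc)
    also have "\<dots> = g 0 z + \<rho> * g 0 y" using s by simp
    finally have "- B \<le> g 0 y" using z \<rho> by (simp add: B_def field_simps)
    then show ?thesis using gN[of 0 y] by simp
  qed
  define D where "D = max (B + 2) 0"
  have lower: "norm (y - y0) / R - D \<le> affine_max x c N y + W y" if y: "y \<in> U" for y
  proof (cases "2 * R \<le> norm (y - y0)")
    case True
    then show ?thesis using far[OF y] by (simp add: D_def)
  next
    case False
    then have "norm (y - y0) / R \<le> 2" using R(1) by (simp add: field_simps)
    then show ?thesis using near[OF y] False by (simp add: D_def)
  qed
  have "(\<integral>\<^sup>+y. ennreal (exp (- affine_max x c N y)) * log_concave_density U W y \<partial>lborel)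
      \<le> (\<integral>\<^sup>+y. ennreal (exp D) * ennreal (exp (- (1 / R) * norm (y - y0))) \<partial>lborel)"
  proof (rule nn_integral_mono)
    fix y
    show "ennreal (exp (- affine_max x c N y)) * log_concave_density U W y \<le> ennreal (exp D) * ennreal (exp (- (1 / R) * norm (y - y0)))"
    proof (cases "y \<in> U")
      case True
      then show ?thesis using lower[OF True]
        by (simp add: log_concave_density_def ennreal_mult[symmetric] exp_add[symmetric] ennreal_leI)
    qed (simp add: log_concave_density_def)
  qed
  also have "\<dots> = ennreal (exp D) * (\<integral>\<^sup>+y. ennreal (exp (- (1 / R) * norm (y - y0))) \<partial>lborel)"
    by (rule nn_integral_cmult) measurable
  also have "\<dots> < \<infinity>"
    using nn_integral_exp_neg_norm_finite[of "1 / R" y0] R(1) by (simp add: ennreal_mult_less_top)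
  finally show ?thesis by blast
qed

section \<open>Weak duality\<close>

lemma ln_ext_eq_minus_infty_iff: "ln_ext z = -\<infinity> \<longleftrightarrow> z = 0"
  by (auto simp: ln_ext_def)

lemma ext_integral_ereal:
  assumes "integrable M u"
  shows "ext_integral M (\<lambda>x. ereal (u x)) = ereal (\<integral>x. u x \<partial>M)"
proof -
  have fin: "(\<integral>\<^sup>+x. ennreal (u x) \<partial>M) \<noteq> \<infinity>" "(\<integral>\<^sup>+x. ennreal (- u x) \<partial>M) \<noteq> \<infinity>"
    using assms by (simp_all add: real_integrable_def)
  then obtain a b where ab: "0 \<le> a" "(\<integral>\<^sup>+x. ennreal (u x) \<partial>M) = ennreal a"
    "0 \<le> b" "(\<integral>\<^sup>+x. ennreal (- u x) \<partial>M) = ennreal b"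
    by (metis ennreal_cases infinity_ennreal_def)
  then show ?thesis
    by (simp add: ext_integral_def real_lebesgue_integral_def[OF assms] enn2ereal_ennreal)
qed

text \<open>
  A point at which the transform is finite is the slope of an affine minorant. Finiteness somewhere is what the
  positivity of the integral of \<open>exp(-f*)\<close> provides.
\<close>
lemma legendre_minorant:
  fixes f :: "'a::real_inner \<Rightarrow> ereal"
  assumes "legendre f y \<noteq> \<infinity>" and "f z \<noteq> \<infinity>" "f z \<noteq> -\<infinity>"
  obtains c where "\<And>x. ereal (x \<bullet> y - c) \<le> f x"
proof -
  have le: "ereal (x \<bullet> y) - f x \<le> legendre f y" for x
    unfolding legendre_def by (rule SUP_upper) simp
  have "legendre f y \<noteq> -\<infinity>" using le[of z] assms(2,3) by (cases "f z") auto
  then obtain c where c: "legendre f y = ereal c" using assms(1) by (cases "legendre f y") auto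
  have "ereal (x \<bullet> y - c) \<le> f x" for x
    using le[of x] unfolding c by (cases "f x") auto
  then show ?thesis by (rule that)
qed

lemma nn_integral_negative_part_finite:
  fixes f :: "'a::euclidean_space \<Rightarrow> ereal"
  assumes \<nu>: "\<nu> \<in> P1" and le: "\<And>x. ereal (x \<bullet> y - c) \<le> f x"
  shows "(\<integral>\<^sup>+x. e2ennreal (- f x) \<partial>\<nu>) < \<infinity>"
proof -
  interpret prob_space \<nu> using \<nu> by (simp add: P1_def)
  have int: "integrable \<nu> (\<lambda>x. norm x * norm y + \<bar>c\<bar>)" using \<nu> by (simp add: P1_def)
  have "(\<integral>\<^sup>+x. e2ennreal (- f x) \<partial>\<nu>) \<le> (\<integral>\<^sup>+x. ennreal (norm x * norm y + \<bar>c\<bar>) \<partial>\<nu>)"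
  proof (rule nn_integral_mono)
    fix x
    have "- f x \<le> ereal (c - x \<bullet> y)" using le[of x] by (cases "f x") auto
    also have "\<dots> \<le> ereal (norm x * norm y + \<bar>c\<bar>)"
      using Cauchy_Schwarz_ineq2[of x y] by (auto simp: abs_le_iff)
    finally have "e2ennreal (- f x) \<le> e2ennreal (ereal (norm x * norm y + \<bar>c\<bar>))" by (rule e2ennreal_mono)
    then show "e2ennreal (- f x) \<le> ennreal (norm x * norm y + \<bar>c\<bar>)" by simp
  qed
  also have "\<dots> < \<infinity>"
    using int unfolding real_integrable_def by (simp add: less_top)
  finally show ?thesis .
qed

lemma ereal_norm_mult_in_lsc_convex:
  assumes "0 \<le> R"
  shows "(\<lambda>x::'a::euclidean_space. ereal (R * norm x)) \<in> lsc_convex"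
proof -
  have "lower_semicontinuous (\<lambda>x::'a. ereal (R * norm x))"
    unfolding lower_semicontinuous_def
  proof
    fix x :: 'a
    have "((\<lambda>x. ereal (R * norm x)) \<longlongrightarrow> ereal (R * norm x)) (at x)" by (intro tendsto_intros)
    then show "ereal (R * norm x) \<le> Liminf (at x) (\<lambda>x. ereal (R * norm x))"
      using lim_imp_Liminf[of "at x"] by (metis at_neq_bot order_refl)
  qed
  moreover have "ext_convex (\<lambda>x::'a. ereal (R * norm x))"
    unfolding ext_convex_def
  proof (intro conjI allI impI)
    fix x y :: 'a and t :: real assume t: "0 < t \<and> t < 1"
    have "norm ((1 - t) *\<^sub>R x + t *\<^sub>R y) \<le> (1 - t) * norm x + t * norm y"
      using norm_triangle_ineq[of "(1 - t) *\<^sub>R x" "t *\<^sub>R y"] t by simp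
    then have "R * norm ((1 - t) *\<^sub>R x + t *\<^sub>R y) \<le> R * ((1 - t) * norm x + t * norm y)"
      using assms by (rule mult_left_mono)
    then show "ereal (R * norm ((1 - t) *\<^sub>R x + t *\<^sub>R y)) \<le> ereal (1 - t) * ereal (R * norm x) + ereal t * ereal (R * norm y)"
      by (simp add: algebra_simps)
  qed auto
  ultimately show ?thesis by (simp add: lsc_convex_def)
qed

lemma K_fun_ge:
  assumes "g \<in> lsc_convex" "ext_integrable \<nu> g"
  shows "ext_integral \<nu> (\<lambda>x. - g x) - L_fun g m \<le> K_fun \<nu> m"
  unfolding K_fun_def using assms by (intro SUP_upper) auto

text \<open>
  The competitor \<open>n |x|\<close> has transform at most zero on the ball of radius \<open>n\<close>, which \<open>m\<close> charges for large \<open>n\<close>.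
  This excludes the difference of two copies of \<open>-\<infinity>\<close> in the duality formula.
\<close>
lemma K_fun_neq_minus_infty:
  fixes m :: "'a::euclidean_space measure"
  assumes sets: "sets m = sets borel" and ne: "emeasure m UNIV \<noteq> 0" and \<nu>: "\<nu> \<in> P1"
  shows "K_fun \<nu> m \<noteq> -\<infinity>"
proof -
  have "(SUP n. emeasure m (cball 0 (real n))) = emeasure m (\<Union>n. cball 0 (real n))"
    by (rule SUP_emeasure_incseq) (auto simp: incseq_def sets)
  also have "(\<Union>n. cball (0::'a) (real n)) = UNIV"
    using real_arch_simple by auto
  finally have sup: "(SUP n. emeasure m (cball 0 (real n))) = emeasure m UNIV" .
  have "\<exists>n. emeasure m (cball 0 (real n)) \<noteq> 0"
  proof (rule ccontr)
    assume "\<not> ?thesis"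
    then have "(SUP n. emeasure m (cball 0 (real n))) = 0" by simp
    then show False using sup ne by simp
  qed
  then obtain n :: nat where n: "emeasure m (cball 0 (real n)) \<noteq> 0" by blast
  define g :: "'a \<Rightarrow> ereal" where "g x = ereal (real n * norm x)" for x
  have g: "g \<in> lsc_convex" unfolding g_def by (rule ereal_norm_mult_in_lsc_convex) simp
  have int: "integrable \<nu> (\<lambda>x. real n * norm x)" using \<nu> by (simp add: P1_def)
  have ext: "ext_integrable \<nu> g"
    using int unfolding ext_integrable_def real_integrable_def g_def by (auto simp: abs_mult less_top)
  have leg: "legendre g y \<le> 0" if "y \<in> cball 0 (real n)" for y
    unfolding legendre_def
  proof (rule SUP_least)
    fix x
    have "x \<bullet> y \<le> norm x * norm y" by (rule norm_cauchy_schwarz)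
    also have "\<dots> \<le> real n * norm x" using that by (subst mult.commute) (auto intro: mult_right_mono)
    finally show "ereal (x \<bullet> y) - g x \<le> 0" by (simp add: g_def zero_ereal_def)
  qed
  have "emeasure m (cball 0 (real n)) = (\<integral>\<^sup>+y. indicator (cball 0 (real n)) y \<partial>m)"
    by (simp add: sets)
  also have "\<dots> \<le> (\<integral>\<^sup>+y. exp_ext (- legendre g y) \<partial>m)"
  proof (rule nn_integral_mono)
    fix y
    show "indicator (cball 0 (real n)) y \<le> exp_ext (- legendre g y)"
    proof (cases "y \<in> cball 0 (real n)")
      case True
      have "exp_ext 0 \<le> exp_ext (- legendre g y)"
        using leg[OF True] by (intro exp_ext_mono) (simp add: ereal_uminus_le_reorder)
      then show ?thesis using True by (simp add: zero_ereal_def)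
    qed simp
  qed
  finally have "(\<integral>\<^sup>+y. exp_ext (- legendre g y) \<partial>m) \<noteq> 0" using n by auto
  then have "L_fun g m \<noteq> \<infinity>" using ln_ext_eq_minus_infty_iff unfolding L_fun_def by (simp add: ereal_uminus_eq_reorder)
  moreover have "ext_integral \<nu> (\<lambda>x. - g x) = ereal (\<integral>x. - (real n * norm x) \<partial>\<nu>)"
    using ext_integral_ereal[of \<nu> "\<lambda>x. - (real n * norm x)"] int by (simp add: g_def)
  ultimately have "ext_integral \<nu> (\<lambda>x. - g x) - L_fun g m \<noteq> -\<infinity>" by (cases "L_fun g m") auto
  then show ?thesis using K_fun_ge[OF g ext, of m] by auto
qed

lemma weak_duality:
  fixes m :: "'a::euclidean_space measure"
  assumes sets: "sets m = sets borel" and f: "f \<in> lsc_convex" and \<nu>: "\<nu> \<in> P1"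
    and pos: "0 < (\<integral>\<^sup>+y. exp_ext (- legendre f y) \<partial>m)"
  shows "ext_integral \<nu> (\<lambda>x. - f x) - K_fun \<nu> m \<le> L_fun f m"
proof -
  have ninf: "f x \<noteq> -\<infinity>" for x using f by (simp add: lsc_convex_def ext_convex_def)
  have L: "L_fun f m \<noteq> \<infinity>"
    using pos ln_ext_eq_minus_infty_iff unfolding L_fun_def by (simp add: ereal_uminus_eq_reorder)
  have "\<exists>y. legendre f y \<noteq> \<infinity>"
  proof (rule ccontr)
    assume "\<not> ?thesis"
    then show False using pos by simp
  qed
  then obtain y where y: "legendre f y \<noteq> \<infinity>" by blast
  obtain z where z: "f z \<noteq> \<infinity>" using f by (auto simp: lsc_convex_def)
  obtain c where c: "\<And>x. ereal (x \<bullet> y - c) \<le> f x" using legendre_minorant[OF y z ninf] by blast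
  have neg: "(\<integral>\<^sup>+x. e2ennreal (- f x) \<partial>\<nu>) < \<infinity>" by (rule nn_integral_negative_part_finite[OF \<nu> c])
  have K: "K_fun \<nu> m \<noteq> -\<infinity>"
  proof (rule K_fun_neq_minus_infty[OF sets _ \<nu>])
    show "emeasure m UNIV \<noteq> 0"
    proof
      assume 0: "emeasure m UNIV = 0"
      then have "AE y in m. False" using sets sets_eq_imp_space_eq[OF sets]
        by (intro AE_I[of _ _ UNIV]) auto
      then have "(\<integral>\<^sup>+y. exp_ext (- legendre f y) \<partial>m) = (\<integral>\<^sup>+y. 0 \<partial>m)"
        by (intro nn_integral_cong_AE) auto
      with pos show False by simp
    qed
  qed
  have f_meas: "f \<in> borel_measurable \<nu>"
    using lower_semicontinuous_imp_borel[of f] f \<nu>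
    by (simp add: lsc_convex_def P1_def cong: measurable_cong_sets)
  show ?thesis
  proof (cases "ext_integrable \<nu> f")
    case True
    have "(\<integral>\<^sup>+x. e2ennreal (f x) \<partial>\<nu>) \<le> (\<integral>\<^sup>+x. e2ennreal \<bar>f x\<bar> \<partial>\<nu>)"
    proof (intro nn_integral_mono e2ennreal_mono)
      show "f x \<le> \<bar>f x\<bar>" for x by (cases "f x") auto
    qed
    also have "\<dots> < \<infinity>" using True by (simp add: ext_integrable_def)
    finally have "(\<integral>\<^sup>+x. e2ennreal (f x) \<partial>\<nu>) < \<infinity>" .
    then obtain a b where "(\<integral>\<^sup>+x. e2ennreal (f x) \<partial>\<nu>) = ennreal a" "0 \<le> a"
      "(\<integral>\<^sup>+x. e2ennreal (- f x) \<partial>\<nu>) = ennreal b" "0 \<le> b"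
      using neg unfolding infinity_ennreal_def less_top_ennreal by blast
    then have "ext_integral \<nu> (\<lambda>x. - f x) = ereal (b - a)"
      by (simp add: ext_integral_def enn2ereal_ennreal)
    then show ?thesis
      using K_fun_ge[OF f True, of m] L K by (cases "K_fun \<nu> m"; cases "L_fun f m") auto
  next
    case False
    (* The negative part is integrable because of the affine minorant, so the positive part is not. *)
    have "(\<integral>\<^sup>+x. e2ennreal \<bar>f x\<bar> \<partial>\<nu>) = \<infinity>" using False f_meas by (simp add: ext_integrable_def flip: less_top)
    moreover have "(\<integral>\<^sup>+x. e2ennreal \<bar>f x\<bar> \<partial>\<nu>) = (\<integral>\<^sup>+x. e2ennreal (f x) + e2ennreal (- f x) \<partial>\<nu>)"
    proof (rule nn_integral_cong)
      fix x
      show "e2ennreal \<bar>f x\<bar> = e2ennreal (f x) + e2ennreal (- f x)"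
        using ninf[of x] by (cases "f x") (auto simp: abs_if ennreal_neg)
    qed
    moreover have "\<dots> = (\<integral>\<^sup>+x. e2ennreal (f x) \<partial>\<nu>) + (\<integral>\<^sup>+x. e2ennreal (- f x) \<partial>\<nu>)"
      using f_meas by (intro nn_integral_add) auto
    ultimately have "(\<integral>\<^sup>+x. e2ennreal (f x) \<partial>\<nu>) = \<infinity>" using neg by (auto simp: less_top)
    moreover obtain b where "(\<integral>\<^sup>+x. e2ennreal (- f x) \<partial>\<nu>) = ennreal b" "0 \<le> b"
      using neg unfolding infinity_ennreal_def less_top_ennreal by blast
    ultimately have "ext_integral \<nu> (\<lambda>x. - f x) = -\<infinity>"
      by (simp add: ext_integral_def enn2ereal_ennreal)
    then show ?thesis using K by (cases "K_fun \<nu> m") auto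
  qed
qed

section \<open>The Gibbs measure of a finite maximum of affine functions\<close>

text \<open>
  Ties are resolved in favour of the smallest index, so that the cells are disjoint; they are the fibres of a
  measurable selection of a subgradient of the maximum.
\<close>
definition first_max_cell :: "(nat \<Rightarrow> 'a::real_inner) \<Rightarrow> (nat \<Rightarrow> real) \<Rightarrow> nat \<Rightarrow> nat \<Rightarrow> 'a set" where
  "first_max_cell x c N i = {y. x i \<bullet> y - c i = affine_max x c N y \<and> (\<forall>j<i. x j \<bullet> y - c j < affine_max x c N y)}"

lemma borel_first_max_cell [measurable]:
  fixes x :: "nat \<Rightarrow> 'a::euclidean_space"
  shows "first_max_cell x c N i \<in> sets borel"
proof -
  have "Measurable.pred borel (\<lambda>y. x i \<bullet> y - c i = affine_max x c N y \<and> (\<forall>j<i. x j \<bullet> y - c j < affine_max x c N y))"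
    by measurable
  then show ?thesis unfolding first_max_cell_def by (simp add: pred_def)
qed

lemma first_max_cells_partition: "(\<Sum>i\<le>N. indicator (first_max_cell x c N i) y :: ennreal) = 1"
proof -
  define P where "P j \<longleftrightarrow> x j \<bullet> y - c j = affine_max x c N y" for j
  obtain i0 where "i0 \<le> N" "P i0" using affine_max_attained[of N x c y] by (auto simp: P_def)
  define i where "i = (LEAST j. P j)"
  have i: "P i" "i \<le> N" using LeastI[of P i0] Least_le[of P i0] \<open>i0 \<le> N\<close> \<open>P i0\<close> by (auto simp: i_def)
  have less: "\<not> P j" if "j < i" for j using not_less_Least[of j P] that by (simp add: i_def)
  have "y \<in> first_max_cell x c N j \<longleftrightarrow> j = i" if "j \<le> N" for j
  proof
    assume "y \<in> first_max_cell x c N j"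
    then have "P j" "\<And>l. l < j \<Longrightarrow> \<not> P l" by (auto simp: first_max_cell_def P_def)
    with i less show "j = i" by (metis linorder_neqE_nat)
  next
    assume "j = i"
    have "x l \<bullet> y - c l < affine_max x c N y" if "l < i" for l
      using affine_max_ge[of l N x y c] less[OF that] i that by (auto simp: P_def)
    with \<open>j = i\<close> i show "y \<in> first_max_cell x c N j" by (auto simp: first_max_cell_def P_def)
  qed
  then have "(\<Sum>j\<le>N. indicator (first_max_cell x c N j) y :: ennreal) = (\<Sum>j\<le>N. if j = i then 1 else 0)"
    by (intro sum.cong) (auto simp: indicator_def)
  also have "\<dots> = 1" using i by simp
  finally show ?thesis .
qed

lemma nn_integral_first_max_cells:
  fixes h :: "'a::euclidean_space \<Rightarrow> ennreal"
  assumes [measurable]: "h \<in> borel_measurable borel"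
  shows "(\<integral>\<^sup>+y. h y \<partial>lborel) = (\<Sum>i\<le>N. \<integral>\<^sup>+y. h y * indicator (first_max_cell x c N i) y \<partial>lborel)"
proof -
  have "(\<integral>\<^sup>+y. h y \<partial>lborel) = (\<integral>\<^sup>+y. (\<Sum>i\<le>N. h y * indicator (first_max_cell x c N i) y) \<partial>lborel)"
    by (simp add: sum_distrib_left[symmetric] first_max_cells_partition)
  also have "\<dots> = (\<Sum>i\<le>N. \<integral>\<^sup>+y. h y * indicator (first_max_cell x c N i) y \<partial>lborel)"
    by (rule nn_integral_sum) measurable
  finally show ?thesis .
qed

text \<open>
  Both sides agree at \<open>t = 0\<close>, so the inequality to the right of zero passes to the derivatives there.
\<close>
lemma exp_bound_imp_derivative_bound:
  fixes p d :: "nat \<Rightarrow> real" and a :: real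
  assumes p: "(\<Sum>i\<in>S. p i) = 1"
    and bound: "\<And>t. 0 < t \<Longrightarrow> t < 1 \<Longrightarrow> exp (t * a) \<le> (\<Sum>i\<in>S. p i * exp (t * d i))"
  shows "a \<le> (\<Sum>i\<in>S. p i * d i)"
proof (rule ccontr)
  assume less: "\<not> ?thesis"
  define D where "D t = (\<Sum>i\<in>S. p i * exp (t * d i)) - exp (t * a)" for t
  have "(D has_real_derivative (\<Sum>i\<in>S. p i * (d i * exp (0 * d i))) - a * exp (0 * a)) (at 0)"
    unfolding D_def by (auto intro!: derivative_eq_intros sum.cong)
  then have D: "(D has_real_derivative (\<Sum>i\<in>S. p i * d i) - a) (at 0)" by simp
  have "(\<Sum>i\<in>S. p i * d i) - a < 0" using less by simp
  from DERIV_neg_dec_right[OF D this]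
  obtain e where e: "0 < e" "\<And>h. 0 < h \<Longrightarrow> h < e \<Longrightarrow> D (0 + h) < D 0" by blast
  define h where "h = min (e / 2) (1 / 2)"
  have h: "0 < h" "h < e" "h < 1" using e(1) by (auto simp: h_def min_def)
  have "D h < D 0" using e(2)[OF h(1,2)] by simp
  also have "D 0 = 0" using p by (simp add: D_def)
  finally show False using bound[OF h(1,3)] by (simp add: D_def)
qed

lemma ennreal_exp_less_mult_exp:
  assumes "ennreal (exp v) < exp_ext z * ennreal (exp (- w))"
  shows "ereal (v + w) < z"
proof -
  have "ennreal (exp (v + w)) < exp_ext z"
  proof (cases z)
    case (real r)
    then show ?thesis using assms
      by (simp add: ennreal_mult[symmetric] exp_add[symmetric] ennreal_less_iff)
  qed (use assms in auto)
  then show ?thesis by (simp add: ennreal_exp_less_exp_ext_iff)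
qed

lemma exp_less_iff_less_ln: "0 < (r::real) \<Longrightarrow> exp u < r \<longleftrightarrow> u < ln r"
  using exp_less_cancel_iff[of u "ln r"] by simp

text \<open>
  The probabilities of the cells under the Gibbs measure with density proportional to \<open>exp(-\<phi>) dm\<close>, where \<open>\<phi>\<close>
  is the maximum of the affine functions.
\<close>
lemma gibbs_weights:
  fixes x :: "nat \<Rightarrow> 'a::euclidean_space"
  assumes U: "open U" "convex U" and W: "convex_on U W"
    and z: "0 < z" "(\<integral>\<^sup>+y. ennreal (exp (- affine_max x c N y)) * log_concave_density U W y \<partial>lborel) = ennreal z"
  obtains p where "\<And>i. 0 \<le> p i" "(\<Sum>i\<le>N. p i) = 1"
    "\<And>i. i \<le> N \<Longrightarrow> (\<integral>\<^sup>+y. ennreal (exp (- affine_max x c N y)) * log_concave_density U W y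
        * indicator (first_max_cell x c N i) y \<partial>lborel) = ennreal (z * p i)"
proof -
  note [measurable] = borel_measurable_log_concave_density[OF U(1) W]
  define I where "I i = (\<integral>\<^sup>+y. ennreal (exp (- affine_max x c N y)) * log_concave_density U W y
        * indicator (first_max_cell x c N i) y \<partial>lborel)" for i
  have sum: "ennreal z = (\<Sum>i\<le>N. I i)"
    unfolding z(2)[symmetric] I_def by (rule nn_integral_first_max_cells) measurable
  have fin: "I i < top" if "i \<le> N" for i
  proof -
    have "I i \<le> (\<Sum>i\<le>N. I i)" using that by (intro member_le_sum) auto
    also have "\<dots> < top" by (simp add: sum[symmetric])
    finally show ?thesis .
  qed
  define p where "p i = enn2real (I i) / z" for i
  have p: "I i = ennreal (z * p i)" if "i \<le> N" for i using fin[OF that] z(1) by (simp add: p_def)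
  have p0: "0 \<le> p i" for i using z(1) by (simp add: p_def)
  have "ennreal z = ennreal (\<Sum>i\<le>N. z * p i)"
    unfolding sum using p p0 z(1) by (subst sum_ennreal[symmetric]) auto
  then have "z = (\<Sum>i\<le>N. z * p i)" using p0 z(1) by (subst (asm) ennreal_inj) (auto intro!: sum_nonneg)
  then have "(\<Sum>i\<le>N. p i) = 1" using z(1) by (simp add: sum_distrib_left[symmetric])
  with p0 show ?thesis using p unfolding I_def by (rule that)
qed

text \<open>
  Let \<open>a\<^sub>i(y) = x\<^sub>i \<bullet> y - c\<^sub>i\<close>. Interpolate between the maximum of the \<open>a\<^sub>i\<close> and the transform of \<open>g\<close> by
  the maximum \<open>\<phi>\<close> of \<open>x\<^sub>i \<bullet> y - (1 - t) c\<^sub>i - t b\<^sub>i\<close> over the indices of positive weight.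
  Prekopa--Leindler bounds \<open>\<integral> exp(-\<phi>)\<close> from below by the geometric mean of the two integrals. From above,
  \<open>\<phi> \<ge> a\<^sub>i - t (b\<^sub>i - c\<^sub>i)\<close> on the \<open>i\<close>-th cell bounds it by \<open>z \<Sum> p\<^sub>i exp(t (b\<^sub>i - c\<^sub>i))\<close>. The
  claim is the first-order comparison at \<open>t = 0\<close>.
  Indices of weight zero are left out of \<open>\<phi>\<close> because \<open>g\<close> may be infinite at their points.
\<close>
lemma gibbs_variational_inequality:
  fixes x :: "nat \<Rightarrow> 'a::euclidean_space"
  assumes U: "open U" "convex U" and W: "convex_on U W"
    and z: "0 < z" "(\<integral>\<^sup>+y. ennreal (exp (- affine_max x c N y)) * log_concave_density U W y \<partial>lborel) = ennreal z"
    and p: "\<And>i. 0 \<le> p i" "(\<Sum>i\<le>N. p i) = 1"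
      "\<And>i. i \<le> N \<Longrightarrow> (\<integral>\<^sup>+y. ennreal (exp (- affine_max x c N y)) * log_concave_density U W y
        * indicator (first_max_cell x c N i) y \<partial>lborel) = ennreal (z * p i)"
    and g: "\<And>i. i \<le> N \<Longrightarrow> 0 < p i \<Longrightarrow> g (x i) = ereal (b i)"
    and v: "ennreal (exp v) < (\<integral>\<^sup>+y. exp_ext (- legendre g y) * log_concave_density U W y \<partial>lborel)"
  shows "v \<le> ln z + (\<Sum>i\<le>N. p i * (b i - c i))"
proof -
  note [measurable] = borel_measurable_log_concave_density[OF U(1) W] borel_measurable_legendre
  define I where "I = {i. i \<le> N \<and> 0 < p i}"
  have I: "finite I" "I \<noteq> {}"
  proof -
    show "I \<noteq> {}"
    proof
      assume "I = {}"
      then have "p i = 0" if "i \<le> N" for i using that p(1)[of i] by (auto simp: I_def less_le)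
      then show False using p(2) by simp
    qed
  qed (simp add: I_def)
  have "exp (t * (v - ln z)) \<le> (\<Sum>i\<le>N. p i * exp (t * (b i - c i)))" if t: "0 < t" "t < 1" for t
  proof -
    define \<phi> where "\<phi> y = (MAX i\<in>I. x i \<bullet> y - (1 - t) * c i - t * b i)" for y
    have [measurable]: "\<phi> \<in> borel_measurable borel"
      unfolding \<phi>_def[abs_def] using I by (intro borel_measurable_Max) measurable
    define h where "h y = ennreal (exp (- \<phi> y)) * log_concave_density U W y" for y
    have [measurable]: "h \<in> borel_measurable borel" unfolding h_def by measurable
    have "geom_mean_le t
      (\<integral>\<^sup>+y. ennreal (exp (- affine_max x c N y)) * log_concave_density U W y \<partial>lborel)
      (\<integral>\<^sup>+y. exp_ext (- legendre g y) * log_concave_density U W y \<partial>lborel) (\<integral>\<^sup>+y. h y \<partial>lborel)"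
    proof (rule prekopa_leindler_lborel[OF t])
      fix y0 y1 :: 'a
      show "geom_mean_le t (ennreal (exp (- affine_max x c N y0)) * log_concave_density U W y0)
          (exp_ext (- legendre g y1) * log_concave_density U W y1) (h ((1 - t) *\<^sub>R y0 + t *\<^sub>R y1))"
      proof (rule geom_mean_leI)
        fix u w
        assume u: "ennreal (exp u) < ennreal (exp (- affine_max x c N y0)) * log_concave_density U W y0"
          and w: "ennreal (exp w) < exp_ext (- legendre g y1) * log_concave_density U W y1"
        have y0: "y0 \<in> U" using u by (cases "y0 \<in> U") (auto simp: log_concave_density_def)
        have y1: "y1 \<in> U" using w by (cases "y1 \<in> U") (auto simp: log_concave_density_def)
        define y where "y = (1 - t) *\<^sub>R y0 + t *\<^sub>R y1"
        have y: "y \<in> U" unfolding y_def using convexD_alt[OF U(2) y0 y1] t by simp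
        have Wy: "W y \<le> (1 - t) * W y0 + t * W y1" unfolding y_def using convex_onD[OF W _ _ y0 y1] t by simp
        have u': "u + W y0 < - affine_max x c N y0"
          using u y0 ennreal_exp_less_mult_exp[of u "ereal (- affine_max x c N y0)" "W y0"] by (simp add: log_concave_density_def)
        have w': "ereal (w + W y1) < - legendre g y1"
          using w y1 by (intro ennreal_exp_less_mult_exp) (simp add: log_concave_density_def)
        (* The Young inequality for g and its transform, at the points x i and y1. *)
        have gi: "w + W y1 \<le> b i - x i \<bullet> y1" if "i \<in> I" for i
        proof -
          have "ereal (x i \<bullet> y1 - b i) \<le> legendre g y1"
            unfolding legendre_def using g[of i] that by (intro SUP_upper2[of "x i"]) (auto simp: I_def)
          with w' have "ereal (w + W y1) \<le> - ereal (x i \<bullet> y1 - b i)"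
            by (meson ereal_minus_le_minus less_imp_le order_trans)
          then show ?thesis by simp
        qed
        have "x i \<bullet> y - (1 - t) * c i - t * b i \<le> - ((1 - t) * (u + W y0)) - t * (w + W y1)" if i: "i \<in> I" for i
        proof -
          have "x i \<bullet> y0 - c i \<le> - (u + W y0)" using affine_max_ge[of i N x y0 c] u' i by (simp add: I_def)
          then have "(1 - t) * (x i \<bullet> y0 - c i) \<le> (1 - t) * - (u + W y0)" using t by (intro mult_left_mono) auto
          moreover have "t * (x i \<bullet> y1 - b i) \<le> t * - (w + W y1)" using gi[OF i] t by (intro mult_left_mono) auto
          ultimately show ?thesis by (simp add: y_def inner_add_right algebra_simps)
        qed
        then have "\<phi> y \<le> - ((1 - t) * (u + W y0)) - t * (w + W y1)"
          unfolding \<phi>_def using I by (subst Max_le_iff) auto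
        with Wy have "(1 - t) * u + t * w \<le> - \<phi> y - W y" by (simp add: algebra_simps)
        then have "exp ((1 - t) * u + t * w) \<le> exp (- \<phi> y) * exp (- W y)" by (simp add: exp_add[symmetric])
        then show "ennreal (exp ((1 - t) * u + t * w)) \<le> h ((1 - t) *\<^sub>R y0 + t *\<^sub>R y1)"
          using y unfolding y_def[symmetric] by (simp add: h_def log_concave_density_def ennreal_mult[symmetric] ennreal_leI)
      qed
    qed measurable
    then have PL: "ennreal (exp ((1 - t) * u + t * v)) \<le> (\<integral>\<^sup>+y. h y \<partial>lborel)" if "u < ln z" for u
    proof (rule geom_mean_leD[OF _ _ v])
      show "ennreal (exp u) < (\<integral>\<^sup>+y. ennreal (exp (- affine_max x c N y)) * log_concave_density U W y \<partial>lborel)"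
        unfolding z(2) using that z(1) by (simp add: ennreal_less_iff exp_less_iff_less_ln)
    qed
    have "(\<integral>\<^sup>+y. h y * indicator (first_max_cell x c N i) y \<partial>lborel) \<le> ennreal (z * p i * exp (t * (b i - c i)))"
      if i: "i \<le> N" for i
    proof (cases "p i = 0")
      case True
      then have "(\<integral>\<^sup>+y. ennreal (exp (- affine_max x c N y)) * log_concave_density U W y * indicator (first_max_cell x c N i) y \<partial>lborel) = 0"
        using p(3)[OF i] by simp
      then have "AE y in lborel. ennreal (exp (- affine_max x c N y)) * log_concave_density U W y * indicator (first_max_cell x c N i) y = 0"
        by (subst (asm) nn_integral_0_iff_AE) measurable
      then have "AE y in lborel. h y * indicator (first_max_cell x c N i) y = 0"
        by eventually_elim (auto simp: h_def)
      then have "(\<integral>\<^sup>+y. h y * indicator (first_max_cell x c N i) y \<partial>lborel) = (\<integral>\<^sup>+(y::'a). 0 \<partial>lborel)"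
        by (rule nn_integral_cong_AE)
      then show ?thesis by simp
    next
      case False
      then have iI: "i \<in> I" using i p(1)[of i] by (simp add: I_def)
      have "(\<integral>\<^sup>+y. h y * indicator (first_max_cell x c N i) y \<partial>lborel)
        \<le> (\<integral>\<^sup>+y. ennreal (exp (t * (b i - c i))) * (ennreal (exp (- affine_max x c N y)) * log_concave_density U W y
              * indicator (first_max_cell x c N i) y) \<partial>lborel)"
      proof (rule nn_integral_mono)
        fix y
        show "h y * indicator (first_max_cell x c N i) y \<le> ennreal (exp (t * (b i - c i))) *
          (ennreal (exp (- affine_max x c N y)) * log_concave_density U W y * indicator (first_max_cell x c N i) y)"
        proof (cases "y \<in> first_max_cell x c N i")
          case True
          have "x i \<bullet> y - (1 - t) * c i - t * b i \<le> \<phi> y"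
            unfolding \<phi>_def using I iI by (intro Max_ge) auto
          moreover have "affine_max x c N y = x i \<bullet> y - c i" using True by (simp add: first_max_cell_def)
          ultimately have "- \<phi> y \<le> t * (b i - c i) - affine_max x c N y" by (simp add: algebra_simps)
          then have "exp (- \<phi> y) \<le> exp (t * (b i - c i)) * exp (- affine_max x c N y)" by (simp add: exp_add[symmetric])
          then have "ennreal (exp (- \<phi> y)) \<le> ennreal (exp (t * (b i - c i))) * ennreal (exp (- affine_max x c N y))"
            by (simp add: ennreal_mult[symmetric] ennreal_leI)
          then have "ennreal (exp (- \<phi> y)) * log_concave_density U W y
              \<le> ennreal (exp (t * (b i - c i))) * ennreal (exp (- affine_max x c N y)) * log_concave_density U W y"
            by (rule mult_right_mono) simp
          then show ?thesis using True by (simp add: h_def mult.assoc)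
        qed simp
      qed
      also have "\<dots> = ennreal (exp (t * (b i - c i))) * ennreal (z * p i)"
        by (subst nn_integral_cmult) (auto simp: p(3)[OF i])
      also have "\<dots> = ennreal (z * p i * exp (t * (b i - c i)))"
        using z(1) p(1)[of i] by (simp add: ennreal_mult[symmetric] mult.commute)
      finally show ?thesis .
    qed
    then have "(\<integral>\<^sup>+y. h y \<partial>lborel) \<le> (\<Sum>i\<le>N. ennreal (z * p i * exp (t * (b i - c i))))"
      unfolding nn_integral_first_max_cells[where x = x and c = c and N = N, OF \<open>h \<in> borel_measurable borel\<close>] by (intro sum_mono) auto
    also have "\<dots> = ennreal (\<Sum>i\<le>N. z * p i * exp (t * (b i - c i)))"
      using z(1) p(1) by (intro sum_ennreal) auto
    finally have h_le: "(\<integral>\<^sup>+y. h y \<partial>lborel) \<le> ennreal (\<Sum>i\<le>N. z * p i * exp (t * (b i - c i)))" .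
    have nn: "0 \<le> (\<Sum>i\<le>N. z * p i * exp (t * (b i - c i)))" using z(1) p(1) by (intro sum_nonneg) auto
    have le: "exp ((1 - t) * u + t * v) \<le> (\<Sum>i\<le>N. z * p i * exp (t * (b i - c i)))" if "u < ln z" for u
      using order_trans[OF PL[OF that] h_le] nn by (simp add: ennreal_le_iff)
    have "((\<lambda>u. exp ((1 - t) * u + t * v)) \<longlongrightarrow> exp ((1 - t) * ln z + t * v)) (at_left (ln z))"
      by (intro tendsto_intros)
    then have "exp ((1 - t) * ln z + t * v) \<le> (\<Sum>i\<le>N. z * p i * exp (t * (b i - c i)))"
      by (rule tendsto_upperbound) (use le in \<open>auto simp: eventually_at_filter\<close>)
    moreover have "(1 - t) * ln z + t * v = ln z + t * (v - ln z)" by (simp add: algebra_simps)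
    ultimately have "z * exp (t * (v - ln z)) \<le> z * (\<Sum>i\<le>N. p i * exp (t * (b i - c i)))"
      using z(1) by (simp add: exp_add sum_distrib_left mult.assoc)
    then show ?thesis using z(1) by simp
  qed
  from exp_bound_imp_derivative_bound[OF p(2) this] show ?thesis by simp
qed

section \<open>Discrete distributions symmetrised by a finite orthogonal group\<close>

text \<open>
  Points with weight zero are allowed; this keeps the index set a full product in the symmetrisation below.
\<close>
definition discrete_distribution :: "'b set \<Rightarrow> ('b \<Rightarrow> real) \<Rightarrow> ('b \<Rightarrow> 'a::euclidean_space) \<Rightarrow> 'a measure" where
  "discrete_distribution S w X = distr (point_measure S (\<lambda>s. ennreal (w s))) borel X"

lemma nn_integral_discrete_distribution:
  assumes "finite S" and [measurable]: "u \<in> borel_measurable borel"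
  shows "(\<integral>\<^sup>+x. u x \<partial>discrete_distribution S w X) = (\<Sum>s\<in>S. ennreal (w s) * u (X s))"
  unfolding discrete_distribution_def
  using assms(1) by (subst nn_integral_distr) (auto simp: nn_integral_point_measure_finite)

lemma emeasure_discrete_distribution:
  assumes "finite S" "A \<in> sets borel"
  shows "emeasure (discrete_distribution S w X) A = (\<Sum>s\<in>S. ennreal (w s) * indicator A (X s))"
proof -
  have "emeasure (discrete_distribution S w X) A = (\<integral>\<^sup>+x. indicator A x \<partial>discrete_distribution S w X)"
    using assms by (simp add: discrete_distribution_def)
  then show ?thesis using assms by (simp add: nn_integral_discrete_distribution)
qed

lemma discrete_distribution_in_P1:
  assumes S: "finite S" and w: "\<And>s. s \<in> S \<Longrightarrow> 0 \<le> w s" "(\<Sum>s\<in>S. w s) = 1"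
  shows "discrete_distribution S w X \<in> P1"
proof -
  define \<nu> where "\<nu> = discrete_distribution S w X"
  have sets[measurable_cong]: "sets \<nu> = sets borel" by (simp add: \<nu>_def discrete_distribution_def)
  have "emeasure \<nu> UNIV = (\<Sum>s\<in>S. ennreal (w s))"
    unfolding \<nu>_def using S by (simp add: emeasure_discrete_distribution)
  also have "\<dots> = 1" using w by (simp add: sum_ennreal)
  finally have "prob_space \<nu>" by (intro prob_spaceI) (simp add: sets_eq_imp_space_eq[OF sets])
  moreover have "(\<integral>\<^sup>+x. ennreal (norm (norm x)) \<partial>\<nu>) < \<infinity>"
    unfolding \<nu>_def using S
    by (subst nn_integral_discrete_distribution) (auto simp: ennreal_mult_less_top)
  then have "integrable \<nu> norm" by (intro integrableI_bounded) auto
  ultimately show ?thesis using sets by (simp add: P1_def \<nu>_def)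
qed

text \<open>
  The values of \<open>u\<close> only matter at atoms of positive weight, so \<open>u\<close> may be infinite elsewhere.
\<close>
lemma ext_integral_discrete_distribution:
  assumes S: "finite S" and w: "\<And>s. s \<in> S \<Longrightarrow> 0 \<le> w s" and [measurable]: "u \<in> borel_measurable borel"
    and u: "\<And>s. s \<in> S \<Longrightarrow> 0 < w s \<Longrightarrow> u (X s) = ereal (r s)"
  shows "ext_integral (discrete_distribution S w X) u = ereal (\<Sum>s\<in>S. w s * r s)"
proof -
  have part: "(\<integral>\<^sup>+x. e2ennreal (v x) \<partial>discrete_distribution S w X) = ennreal (\<Sum>s\<in>S. w s * max 0 (q s))"
    if [measurable]: "v \<in> borel_measurable borel" and v: "\<And>s. s \<in> S \<Longrightarrow> 0 < w s \<Longrightarrow> v (X s) = ereal (q s)"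
    for v q
  proof -
    have "(\<integral>\<^sup>+x. e2ennreal (v x) \<partial>discrete_distribution S w X) = (\<Sum>s\<in>S. ennreal (w s) * e2ennreal (v (X s)))"
      by (rule nn_integral_discrete_distribution[OF S]) measurable
    also have "\<dots> = (\<Sum>s\<in>S. ennreal (w s * max 0 (q s)))"
    proof (rule sum.cong)
      fix s assume s: "s \<in> S"
      show "ennreal (w s) * e2ennreal (v (X s)) = ennreal (w s * max 0 (q s))"
      proof (cases "w s = 0")
        case False
        then have "0 < w s" using w[OF s] by simp
        then have "ennreal (w s) * e2ennreal (v (X s)) = ennreal (w s) * ennreal (q s)" using v[OF s] by simp
        also have "ennreal (q s) = ennreal (max 0 (q s))" by (auto simp: max_def ennreal_neg)
        finally show ?thesis by (simp only: ennreal_mult[OF w[OF s] max.cobounded1])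
      qed simp
    qed simp
    also have "\<dots> = ennreal (\<Sum>s\<in>S. w s * max 0 (q s))" using w by (intro sum_ennreal) auto
    finally show ?thesis .
  qed
  have nn: "0 \<le> (\<Sum>s\<in>S. w s * max 0 (q s))" for q using w by (intro sum_nonneg) auto
  have "ext_integral (discrete_distribution S w X) u
      = ereal ((\<Sum>s\<in>S. w s * max 0 (r s)) - (\<Sum>s\<in>S. w s * max 0 (- r s)))"
    unfolding ext_integral_def using part[of u r] part[of "\<lambda>x. - u x" "\<lambda>s. - r s"] u nn
    by (simp add: enn2ereal_ennreal)
  also have "(\<Sum>s\<in>S. w s * max 0 (r s)) - (\<Sum>s\<in>S. w s * max 0 (- r s)) = (\<Sum>s\<in>S. w s * r s)"
    unfolding sum_subtractf[symmetric] by (intro sum.cong) (auto simp: max_def)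
  finally show ?thesis .
qed

lemma ext_integrable_discrete_distribution_finite:
  assumes S: "finite S" "s \<in> S" "0 < w s" and u: "ext_integrable (discrete_distribution S w X) u"
  shows "\<bar>u (X s)\<bar> \<noteq> \<infinity>"
proof
  assume inf: "\<bar>u (X s)\<bar> = \<infinity>"
  have [measurable]: "u \<in> borel_measurable borel"
    using u by (simp add: ext_integrable_def discrete_distribution_def)
  have "(\<integral>\<^sup>+x. e2ennreal \<bar>u x\<bar> \<partial>discrete_distribution S w X) = (\<Sum>s\<in>S. ennreal (w s) * e2ennreal \<bar>u (X s)\<bar>)"
    by (rule nn_integral_discrete_distribution[OF S(1)]) measurable
  moreover have "ennreal (w s) * e2ennreal \<bar>u (X s)\<bar> \<le> (\<Sum>s\<in>S. ennreal (w s) * e2ennreal \<bar>u (X s)\<bar>)"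
    using S by (intro member_le_sum) auto
  moreover have "ennreal (w s) * e2ennreal \<bar>u (X s)\<bar> = \<infinity>"
    using S(3) inf by (simp add: ennreal_mult_top)
  ultimately show False using u by (simp add: ext_integrable_def top_unique)
qed

text \<open>
  For a finite set of invertible maps, closure under composition already makes it a group.
\<close>
definition orthogonal_group :: "('a::euclidean_space \<Rightarrow> 'a) set \<Rightarrow> bool" where
  "orthogonal_group H \<longleftrightarrow> finite H \<and> H \<noteq> {} \<and>
     (\<forall>h\<in>H. orthogonal_transformation h) \<and> (\<forall>h\<in>H. \<forall>k\<in>H. h \<circ> k \<in> H)"

lemma orthogonal_group_bij_betw:
  assumes "orthogonal_group H" "k \<in> H"
  shows "bij_betw ((\<circ>) k) H H"
proof -
  have "inj k" using assms by (auto simp: orthogonal_group_def intro: orthogonal_transformation_inj)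
  then have "inj_on ((\<circ>) k) H" by (auto simp: inj_on_def fun_eq_iff)
  moreover have "(\<circ>) k ` H \<subseteq> H" "finite H" using assms by (auto simp: orthogonal_group_def)
  ultimately show ?thesis by (simp add: bij_betw_def endo_inj_surj)
qed

lemma borel_measurable_orthogonal_transformation:
  fixes h :: "'a::euclidean_space \<Rightarrow> 'a"
  assumes "orthogonal_transformation h"
  shows "h \<in> borel_measurable borel"
  using assms by (intro borel_measurable_continuous_onI linear_continuous_on)
    (simp add: orthogonal_transformation_def linear_conv_bounded_linear)

lemma legendre_orthogonal:
  fixes h :: "'a::euclidean_space \<Rightarrow> 'a"
  assumes "orthogonal_transformation h"
  shows "legendre (\<lambda>x. g (h x)) y = legendre g (h y)"
proof -
  have "surj h" using assms by (rule orthogonal_transformation_surj)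
  have inner: "\<And>x y. h x \<bullet> h y = x \<bullet> y" using assms by (simp add: orthogonal_transformation_def)
  have "legendre g (h y) = (SUP x\<in>range h. ereal (x \<bullet> h y) - g x)" by (simp add: legendre_def \<open>surj h\<close>)
  also have "\<dots> = legendre (\<lambda>x. g (h x)) y" by (simp add: legendre_def image_image inner)
  finally show ?thesis by simp
qed

text \<open>
  Left multiplication by \<open>k\<close> permutes the group, hence the atoms of equal weight.
\<close>
lemma distr_discrete_distribution_invariant:
  fixes H :: "('a::euclidean_space \<Rightarrow> 'a) set" and w :: "'i \<Rightarrow> real" and x :: "'i \<Rightarrow> 'a"
  assumes H: "orthogonal_group H" and k: "k \<in> H" and I: "finite I"
  defines "\<nu> \<equiv> discrete_distribution (H \<times> I) (\<lambda>(h, i). w i) (\<lambda>(h, i). h (x i))"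
  shows "distr \<nu> borel k = \<nu>"
proof (rule measure_eqI)
  have [measurable]: "k \<in> borel_measurable borel"
    using H k by (auto simp: orthogonal_group_def intro: borel_measurable_orthogonal_transformation)
  have bij: "bij_betw ((\<circ>) k) H H" by (rule orthogonal_group_bij_betw[OF H k])
  have fin: "finite (H \<times> I)" using H I by (auto simp: orthogonal_group_def)
  have sets: "sets \<nu> = sets borel" by (simp add: \<nu>_def discrete_distribution_def)
  fix A assume "A \<in> sets (distr \<nu> borel k)"
  then have [measurable]: "A \<in> sets borel" by simp
  have pre: "k -` A \<in> sets borel" using measurable_sets[of k borel borel A] by simp
  have "emeasure (distr \<nu> borel k) A = emeasure \<nu> (k -` A)"
    using sets_eq_imp_space_eq[OF sets] by (subst emeasure_distr) (auto simp: measurable_cong_sets[OF sets refl])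
  also have "\<dots> = (\<Sum>(h, i)\<in>H \<times> I. ennreal (w i) * indicator A (k (h (x i))))"
    unfolding \<nu>_def emeasure_discrete_distribution[OF fin pre] by (intro sum.cong) (auto simp: indicator_def)
  also have "\<dots> = (\<Sum>h\<in>H. \<Sum>i\<in>I. ennreal (w i) * indicator A ((k \<circ> h) (x i)))"
    by (simp add: sum.cartesian_product)
  also have "\<dots> = (\<Sum>h\<in>H. \<Sum>i\<in>I. ennreal (w i) * indicator A (h (x i)))"
    by (rule sum.reindex_bij_betw[OF bij])
  also have "\<dots> = emeasure \<nu> A"
    unfolding \<nu>_def by (subst emeasure_discrete_distribution[OF fin]) (auto simp: sum.cartesian_product intro!: sum.cong)
  finally show "emeasure (distr \<nu> borel k) A = emeasure \<nu> A" .
qed (simp add: discrete_distribution_def \<nu>_def)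

section \<open>Strong duality\<close>

text \<open>
  The measure is \<open>\<Sum> p\<^sub>i \<delta>(x\<^sub>i)\<close> averaged over the group. For a competitor \<open>g\<close> the variational inequality is
  applied to each \<open>g \<circ> h\<close>, which has the same value of \<open>L\<close> since \<open>h\<close> is orthogonal and preserves \<open>m\<close>, and
  the resulting inequalities are averaged.
\<close>
lemma almost_optimal_measure:
  fixes m :: "'a::euclidean_space measure" and x :: "nat \<Rightarrow> 'a"
  assumes U: "open U" "convex U" and W: "convex_on U W" and m: "m = density lborel (log_concave_density U W)"
    and f: "f \<in> lsc_convex" "\<And>i. f (x i) = ereal (c i)"
    and z: "0 < z" "(\<integral>\<^sup>+y. ennreal (exp (- affine_max x c N y)) * log_concave_density U W y \<partial>lborel) = ennreal z"
    and H: "orthogonal_group H" and Hm: "\<And>h. h \<in> H \<Longrightarrow> distr m borel h = m" and Hf: "\<And>h x. h \<in> H \<Longrightarrow> f (h x) = f x"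
  shows "\<exists>\<nu>\<in>P1. (\<forall>h\<in>H. distr \<nu> borel h = \<nu>) \<and> - ereal (ln z) \<le> ext_integral \<nu> (\<lambda>x. - f x) - K_fun \<nu> m"
proof -
  note [measurable] = borel_measurable_log_concave_density[OF U(1) W] borel_measurable_legendre
  obtain p where p: "\<And>i. 0 \<le> p i" "(\<Sum>i\<le>N. p i) = 1"
    "\<And>i. i \<le> N \<Longrightarrow> (\<integral>\<^sup>+y. ennreal (exp (- affine_max x c N y)) * log_concave_density U W y
        * indicator (first_max_cell x c N i) y \<partial>lborel) = ennreal (z * p i)"
    using gibbs_weights[OF U W z] by blast
  define n where "n = real (card H)"
  have fin_H: "finite H" and n: "0 < n" using H by (auto simp: orthogonal_group_def n_def card_gt_0_iff)
  define S where "S = H \<times> {..N}"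
  define w where "w = (\<lambda>(h :: 'a \<Rightarrow> 'a, i). p i / n)"
  define X where "X = (\<lambda>(h :: 'a \<Rightarrow> 'a, i). h (x i))"
  define \<nu> where "\<nu> = discrete_distribution S w X"
  have S: "finite S" using fin_H by (simp add: S_def)
  have w0: "0 \<le> w s" for s using p(1) n by (simp add: w_def split: prod.split)
  have sum_S: "(\<Sum>(h, i)\<in>S. F h i) = (\<Sum>h\<in>H. \<Sum>i\<le>N. F h i)" for F :: "_ \<Rightarrow> _ \<Rightarrow> real"
    by (simp add: S_def sum.cartesian_product)
  have "(\<Sum>s\<in>S. w s) = (\<Sum>h\<in>H. \<Sum>i\<le>N. p i / n)" unfolding w_def by (rule sum_S)
  also have "\<dots> = 1" using n by (simp add: sum_divide_distrib[symmetric] p(2) n_def)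
  finally have w1: "(\<Sum>s\<in>S. w s) = 1" .
  have \<nu>_P1: "\<nu> \<in> P1" unfolding \<nu>_def using S w0 w1 by (rule discrete_distribution_in_P1)
  have inv: "distr \<nu> borel h = \<nu>" if "h \<in> H" for h
    unfolding \<nu>_def S_def w_def X_def by (rule distr_discrete_distribution_invariant[OF H that]) simp
  have f_meas[measurable]: "f \<in> borel_measurable borel" using f(1) by (simp add: lsc_convex_def lower_semicontinuous_imp_borel)
  have "ext_integral \<nu> (\<lambda>x. - f x) = ereal (\<Sum>s\<in>S. w s * - c (snd s))"
    unfolding \<nu>_def by (rule ext_integral_discrete_distribution[OF S w0]) (auto simp: S_def X_def Hf f(2))
  also have "(\<Sum>s\<in>S. w s * - c (snd s)) = (\<Sum>h\<in>H. \<Sum>i\<le>N. - (p i * c i / n))"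
    unfolding sum_S[symmetric] by (intro sum.cong) (auto simp: w_def)
  also have "\<dots> = - (\<Sum>i\<le>N. p i * c i)" using n by (simp add: sum_negf sum_divide_distrib[symmetric] n_def)
  finally have int_f: "ext_integral \<nu> (\<lambda>x. - f x) = ereal (- (\<Sum>i\<le>N. p i * c i))" .
  have int_m: "(\<integral>\<^sup>+y. u y \<partial>m) = (\<integral>\<^sup>+y. u y * log_concave_density U W y \<partial>lborel)" if [measurable]: "u \<in> borel_measurable borel" for u
    unfolding m by (subst nn_integral_density) (auto simp: mult.commute)
  have "K_fun \<nu> m \<le> ereal (ln z - (\<Sum>i\<le>N. p i * c i))"
    unfolding K_fun_def
  proof (rule SUP_least)
    fix g assume "g \<in> {g \<in> lsc_convex. ext_integrable \<nu> g}"
    then have g: "g \<in> lsc_convex" "ext_integrable \<nu> g" by auto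
    have [measurable]: "g \<in> borel_measurable borel" using g(1) by (simp add: lsc_convex_def lower_semicontinuous_imp_borel)
    define b where "b h i = real_of_ereal (g (h (x i)))" for h :: "'a \<Rightarrow> 'a" and i
    have gb: "g (h (x i)) = ereal (b h i)" if "h \<in> H" "i \<le> N" "0 < p i" for h i
    proof -
      have "\<bar>g (X (h, i))\<bar> \<noteq> \<infinity>"
        using g(2) unfolding \<nu>_def
        by (intro ext_integrable_discrete_distribution_finite[OF S]) (use that n in \<open>auto simp: S_def w_def\<close>)
      then show ?thesis by (auto simp: X_def b_def ereal_real)
    qed
    have "ext_integral \<nu> (\<lambda>x. - g x) = ereal (\<Sum>s\<in>S. w s * - b (fst s) (snd s))"
      unfolding \<nu>_def by (rule ext_integral_discrete_distribution[OF S w0])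
        (use n gb in \<open>auto simp: S_def X_def w_def zero_less_divide_iff\<close>)
    also have "(\<Sum>s\<in>S. w s * - b (fst s) (snd s)) = (\<Sum>h\<in>H. \<Sum>i\<le>N. - (p i * b h i / n))"
      unfolding sum_S[symmetric] by (intro sum.cong) (auto simp: w_def)
    also have "\<dots> = - (\<Sum>h\<in>H. \<Sum>i\<le>N. p i * b h i) / n" by (simp add: sum_negf sum_divide_distrib)
    finally have int_g: "ext_integral \<nu> (\<lambda>x. - g x) = ereal (- (\<Sum>h\<in>H. \<Sum>i\<le>N. p i * b h i) / n)" .
    define G where "G = (\<integral>\<^sup>+y. exp_ext (- legendre g y) \<partial>m)"
    have gibbs: "v \<le> ln z + (\<Sum>i\<le>N. p i * (b h i - c i))" if v: "ennreal (exp v) < G" and h: "h \<in> H" for v h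
    proof (rule gibbs_variational_inequality[OF U W z p])
      show "g (h (x i)) = ereal (b h i)" if "i \<le> N" "0 < p i" for i using gb h that by blast
      have h': "orthogonal_transformation h" using H h by (auto simp: orthogonal_group_def)
      have [measurable]: "h \<in> borel_measurable borel" by (rule borel_measurable_orthogonal_transformation[OF h'])
      have "G = (\<integral>\<^sup>+y. exp_ext (- legendre g y) \<partial>distr m borel h)" unfolding Hm[OF h] G_def ..
      also have "\<dots> = (\<integral>\<^sup>+y. exp_ext (- legendre g (h y)) \<partial>m)"
        unfolding m by (subst nn_integral_distr) auto
      also have "\<dots> = (\<integral>\<^sup>+y. exp_ext (- legendre (\<lambda>x. g (h x)) y) \<partial>m)"
        by (simp add: legendre_orthogonal[OF h'])
      also have "\<dots> = (\<integral>\<^sup>+y. exp_ext (- legendre (\<lambda>x. g (h x)) y) * log_concave_density U W y \<partial>lborel)"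
        by (rule int_m) measurable
      finally show "ennreal (exp v) < (\<integral>\<^sup>+y. exp_ext (- legendre (\<lambda>x. g (h x)) y) * log_concave_density U W y \<partial>lborel)"
        using v by simp
    qed
    define B where "B = ln z + (\<Sum>h\<in>H. \<Sum>i\<le>N. p i * b h i) / n - (\<Sum>i\<le>N. p i * c i)"
    have avg: "v \<le> B" if "ennreal (exp v) < G" for v
    proof -
      have "n * v = (\<Sum>h\<in>H. v)" by (simp add: n_def)
      also have "\<dots> \<le> (\<Sum>h\<in>H. ln z + (\<Sum>i\<le>N. p i * (b h i - c i)))" by (intro sum_mono gibbs that)
      also have "\<dots> = n * ln z + (\<Sum>h\<in>H. \<Sum>i\<le>N. p i * b h i) - n * (\<Sum>i\<le>N. p i * c i)"
        by (simp add: n_def sum.distrib sum_subtractf right_diff_distrib)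
      also have "\<dots> = n * B" using n by (simp add: B_def field_simps)
      finally show ?thesis using n by simp
    qed
    have "ln_ext G \<le> ereal B"
    proof (rule dense_le)
      fix e assume e: "e < ln_ext G"
      show "e \<le> ereal B"
      proof (cases e)
        case (real v)
        have "ennreal (exp v) < G"
        proof (cases "G = \<infinity> \<or> G = 0")
          case True then show ?thesis using e by (auto simp: ln_ext_def)
        next
          case False
          then obtain r where r: "G = ennreal r" "0 < r" by (cases G) (auto simp: less_le)
          then show ?thesis using e real by (simp add: ln_ext_def ennreal_less_iff exp_less_iff_less_ln)
        qed
        then show ?thesis using avg real by simp
      qed (use e in auto)
    qed
    moreover have "L_fun g m = - ln_ext G" by (simp add: L_fun_def G_def)
    ultimately show "ext_integral \<nu> (\<lambda>x. - g x) - L_fun g m \<le> ereal (ln z - (\<Sum>i\<le>N. p i * c i))"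
      unfolding int_g by (cases "ln_ext G") (auto simp: B_def)
  qed
  then have "- ereal (ln z) \<le> ext_integral \<nu> (\<lambda>x. - f x) - K_fun \<nu> m"
    unfolding int_f by (cases "K_fun \<nu> m") auto
  with \<nu>_P1 inv show ?thesis by blast
qed

text \<open>
  The approximating measures have the value at least \<open>-ln Z\<^sub>N\<close>, and \<open>Z\<^sub>N\<close> decreases to the integral of
  \<open>exp(-f*)\<close>. If that integral is infinite, \<open>L\<close> is \<open>-\<infinity>\<close> and there is nothing to show.
\<close>
lemma duality_invariant:
  fixes m :: "'a::euclidean_space measure"
  assumes m: "log_concave_measure m" and f: "f \<in> lsc_convex"
    and pos: "0 < (\<integral>\<^sup>+y. exp_ext (- legendre f y) \<partial>m)"
    and H: "orthogonal_group H" and Hm: "\<And>h. h \<in> H \<Longrightarrow> distr m borel h = m" and Hf: "\<And>h x. h \<in> H \<Longrightarrow> f (h x) = f x"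
  shows "(SUP \<nu>\<in>{\<nu>\<in>P1. \<forall>h\<in>H. distr \<nu> borel h = \<nu>}. ext_integral \<nu> (\<lambda>x. - f x) - K_fun \<nu> m) = L_fun f m"
    (is "?S = _")
proof (rule antisym)
  have sets: "sets m = sets borel" using m by (simp add: log_concave_measure_def)
  show "?S \<le> L_fun f m"
    by (rule SUP_least) (use weak_duality[OF sets f _ pos] in auto)
  show "L_fun f m \<le> ?S"
  proof (cases "(\<integral>\<^sup>+y. exp_ext (- legendre f y) \<partial>m) = \<infinity>")
    case True
    then show ?thesis by (simp add: L_fun_def ln_ext_def)
  next
    case False
    obtain U W where U: "open U" "convex U" and W: "convex_on U W" and md: "m = density lborel (log_concave_density U W)"
      using log_concave_measure_eq_density[OF m] by blast
    note [measurable] = borel_measurable_log_concave_density[OF U(1) W] borel_measurable_legendre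
    have int_m: "(\<integral>\<^sup>+y. u y \<partial>m) = (\<integral>\<^sup>+y. u y * log_concave_density U W y \<partial>lborel)" if [measurable]: "u \<in> borel_measurable borel" for u
      unfolding md by (subst nn_integral_density) (auto simp: mult.commute)
    have "\<And>x. f x \<noteq> -\<infinity>" "\<exists>x. f x \<noteq> \<infinity>" using f by (auto simp: lsc_convex_def ext_convex_def)
    then obtain x c where fx: "\<And>i. f (x i) = ereal (c i)" and leg: "\<And>y. legendre f y = affine_sup x c y"
      by (rule legendre_eq_affine_sup[of f]) blast
    have leg': "legendre f = affine_sup x c" using leg by (rule ext)
    obtain z where z: "(\<integral>\<^sup>+y. exp_ext (- legendre f y) \<partial>m) = ennreal z" "0 < z"
      using False pos by (cases "\<integral>\<^sup>+y. exp_ext (- legendre f y) \<partial>m") (auto simp: less_le)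
    have z': "(\<integral>\<^sup>+y. exp_ext (- affine_sup x c y) * log_concave_density U W y \<partial>lborel) = ennreal z"
      using z(1) int_m[of "\<lambda>y. exp_ext (- legendre f y)"] unfolding leg' by (simp add: leg'[symmetric])
    obtain M where M: "(\<integral>\<^sup>+y. ennreal (exp (- affine_max x c M y)) * log_concave_density U W y \<partial>lborel) < \<infinity>"
      using affine_max_integrable[OF U W, of x c] z(2) by (auto simp: z')
    define F where "F k = (\<integral>\<^sup>+y. ennreal (exp (- affine_max x c (M + k) y)) \<partial>m)" for k
    have F_lborel: "F k = (\<integral>\<^sup>+y. ennreal (exp (- affine_max x c (M + k) y)) * log_concave_density U W y \<partial>lborel)" for k
      unfolding F_def by (rule int_m) measurable
    have lim: "F \<longlonglongrightarrow> ennreal z"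
      unfolding F_def z(1)[symmetric] leg'
      by (rule affine_max_integral_tendsto[OF sets]) (use M F_lborel[of 0] in \<open>simp add: F_def\<close>)
    have "\<exists>r. F k = ennreal r \<and> 0 < r" for k
    proof -
      have "F k \<le> F 0" unfolding F_def by (intro nn_integral_mono ennreal_leI) (simp add: affine_max_mono)
      also have "F 0 < top" using M F_lborel[of 0] by simp
      finally obtain r where r: "F k = ennreal r" "0 \<le> r" unfolding less_top_ennreal by blast
      have "ennreal z \<le> F k"
        unfolding z(1)[symmetric] F_def leg'
      proof (rule nn_integral_mono)
        fix y
        have "- affine_sup x c y \<le> - ereal (affine_max x c (M + k) y)"
          using affine_max_le_affine_sup[of x c "M + k" y] by (simp only: ereal_minus_le_minus)
        from exp_ext_mono[OF this]
        show "exp_ext (- affine_sup x c y) \<le> ennreal (exp (- affine_max x c (M + k) y))" by simp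
      qed
      then have "0 < F k" using z(2) by (metis ennreal_eq_0_iff less_le_trans not_le zero_less_iff_neq_zero)
      with r show ?thesis by auto
    qed
    then obtain \<zeta> where \<zeta>: "\<And>k. F k = ennreal (\<zeta> k)" "\<And>k. 0 < \<zeta> k" by metis
    have le: "- ereal (ln (\<zeta> k)) \<le> ?S" for k
    proof -
      have eq: "(\<integral>\<^sup>+y. ennreal (exp (- affine_max x c (M + k) y)) * log_concave_density U W y \<partial>lborel) = ennreal (\<zeta> k)"
        using F_lborel[of k] \<zeta>(1)[of k] by simp
      have "\<exists>\<nu>\<in>P1. (\<forall>h\<in>H. distr \<nu> borel h = \<nu>) \<and>
          - ereal (ln (\<zeta> k)) \<le> ext_integral \<nu> (\<lambda>x. - f x) - K_fun \<nu> m"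
        by (rule almost_optimal_measure[where x = x and c = c and N = "M + k" and U = U and W = W])
          (fact U W md f fx \<zeta>(2) eq H Hm Hf)+
      then obtain \<nu> where "\<nu> \<in> P1" "\<forall>h\<in>H. distr \<nu> borel h = \<nu>"
        "- ereal (ln (\<zeta> k)) \<le> ext_integral \<nu> (\<lambda>x. - f x) - K_fun \<nu> m" by blast
      then show ?thesis by (intro SUP_upper2[of \<nu>]) auto
    qed
    have "\<zeta> \<longlonglongrightarrow> z"
      using lim \<zeta> z(2) by (subst (asm) tendsto_cong[where g = "\<lambda>k. ennreal (\<zeta> k)"]) (auto simp: less_imp_le)
    then have "(\<lambda>k. - ereal (ln (\<zeta> k))) \<longlonglongrightarrow> - ereal (ln z)"
      using z(2) by (auto intro!: tendsto_minus tendsto_ln)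
    then have "- ereal (ln z) \<le> ?S" by (rule LIMSEQ_le_const2) (use le in auto)
    then show ?thesis using z by (simp add: L_fun_def ln_ext_def)
  qed
qed

lemma orthogonal_group_id: "orthogonal_group {id}"
  by (auto simp: orthogonal_group_def orthogonal_transformation_def linear_id)

lemma orthogonal_group_uminus: "orthogonal_group {id, uminus}"
  by (auto simp: orthogonal_group_def orthogonal_transformation_def linear_id fun_eq_iff intro: linear_uminus)

definition sign_flips :: "(real^'n \<Rightarrow> real^'n) set" where
  "sign_flips = flip ` {\<epsilon>. \<forall>i. \<epsilon> i \<in> {-1, 1}}"

lemma orthogonal_group_sign_flips: "orthogonal_group (sign_flips :: (real^'n \<Rightarrow> real^'n) set)"
proof -
  have "{\<epsilon>. \<forall>i. \<epsilon> i \<in> {-1, 1}} = (PiE UNIV (\<lambda>_. {-1, 1}) :: ('n \<Rightarrow> real) set)"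
    by (auto simp: PiE_def Pi_def)
  then have "finite {\<epsilon> :: 'n \<Rightarrow> real. \<forall>i. \<epsilon> i \<in> {-1, 1}}" by (simp only: finite_PiE finite finite.intros)
  moreover have "orthogonal_transformation (flip \<epsilon>)" if "\<forall>i. \<epsilon> i \<in> {-1, 1}" for \<epsilon> :: "'n \<Rightarrow> real"
  proof -
    have "\<epsilon> i * \<epsilon> i = 1" for i using that[rule_format, of i] by auto
    then have sq: "\<epsilon> i * (\<epsilon> i * a) = a" for i a by (simp flip: mult.assoc)
    show ?thesis
      unfolding orthogonal_transformation_def
      by (auto simp: flip_def inner_vec_def linear_iff vec_eq_iff algebra_simps sq)
  qed
  moreover have "flip \<epsilon> \<circ> flip \<delta> \<in> sign_flips"
    if "\<forall>i. \<epsilon> i \<in> {-1, 1}" "\<forall>i. \<delta> i \<in> {-1, 1}" for \<epsilon> \<delta> :: "'n \<Rightarrow> real"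
  proof -
    have "flip \<epsilon> \<circ> flip \<delta> = flip (\<lambda>i. \<epsilon> i * \<delta> i)"
      by (auto simp: fun_eq_iff flip_def mult.assoc)
    moreover have "\<epsilon> i * \<delta> i \<in> {-1, 1}" for i using that(1)[rule_format, of i] that(2)[rule_format, of i] by auto
    ultimately show ?thesis unfolding sign_flips_def by blast
  qed
  ultimately show ?thesis unfolding orthogonal_group_def by (auto simp: sign_flips_def)
qed

lemma distr_borel_id: "sets \<nu> = sets borel \<Longrightarrow> distr \<nu> borel id = \<nu>"
  using distr_id2[of borel \<nu>] by (simp add: id_def)

theorem theorem4:
  fixes m :: "(real^'n) measure" and f :: "real^'n \<Rightarrow> ereal"
  assumes "log_concave_measure m"
    and "f \<in> lsc_convex"
    and "(\<integral>\<^sup>+y. exp_ext (- legendre f y) \<partial>m) > 0"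
  shows "(SUP \<nu>\<in>P1. ext_integral \<nu> (\<lambda>x. - f x) - K_fun \<nu> m) = L_fun f m
    \<and> (uncond_measure m \<and> uncond_fun f \<longrightarrow>
         (SUP \<nu>\<in>Pu1. ext_integral \<nu> (\<lambda>x. - f x) - K_fun \<nu> m) = L_fun f m)
    \<and> (sym_measure m \<and> sym_fun f \<longrightarrow>
         (SUP \<nu>\<in>Ps1. ext_integral \<nu> (\<lambda>x. - f x) - K_fun \<nu> m) = L_fun f m)"
proof (intro conjI impI)
  have sets: "sets m = sets borel" using assms(1) by (simp add: log_concave_measure_def)
  have "{\<nu>\<in>P1. \<forall>h\<in>{id}. distr \<nu> borel h = \<nu>} = (P1 :: (real^'n) measure set)"
    by (auto simp: P1_def distr_borel_id)
  moreover have "(SUP \<nu>\<in>{\<nu>\<in>P1. \<forall>h\<in>{id}. distr \<nu> borel h = \<nu>}. ext_integral \<nu> (\<lambda>x. - f x) - K_fun \<nu> m) = L_fun f m"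
    by (rule duality_invariant[OF assms orthogonal_group_id]) (use sets in \<open>auto simp: distr_borel_id\<close>)
  ultimately show "(SUP \<nu>\<in>P1. ext_integral \<nu> (\<lambda>x. - f x) - K_fun \<nu> m) = L_fun f m" by simp
  {
    assume unc: "uncond_measure m \<and> uncond_fun f"
    have "{\<nu>\<in>P1. \<forall>h\<in>sign_flips. distr \<nu> borel h = \<nu>} = (Pu1 :: (real^'n) measure set)"
      unfolding Pu1_def uncond_measure_def sign_flips_def by blast
    moreover have "(SUP \<nu>\<in>{\<nu>\<in>P1. \<forall>h\<in>sign_flips. distr \<nu> borel h = \<nu>}. ext_integral \<nu> (\<lambda>x. - f x) - K_fun \<nu> m) = L_fun f m"
    proof (rule duality_invariant[OF assms orthogonal_group_sign_flips])
      fix h :: "real^'n \<Rightarrow> real^'n" and x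
      assume "h \<in> sign_flips"
      then show "distr m borel h = m" and "f (h x) = f x"
        using unc unfolding sign_flips_def uncond_measure_def uncond_fun_def by blast+
    qed
    ultimately show "(SUP \<nu>\<in>Pu1. ext_integral \<nu> (\<lambda>x. - f x) - K_fun \<nu> m) = L_fun f m" by simp
  next
    assume sym: "sym_measure m \<and> sym_fun f"
    have "{\<nu>\<in>P1. \<forall>h\<in>{id, uminus}. distr \<nu> borel h = \<nu>} = (Ps1 :: (real^'n) measure set)"
      by (auto simp: Ps1_def P1_def sym_measure_def distr_borel_id)
    moreover have "(SUP \<nu>\<in>{\<nu>\<in>P1. \<forall>h\<in>{id, uminus}. distr \<nu> borel h = \<nu>}. ext_integral \<nu> (\<lambda>x. - f x) - K_fun \<nu> m) = L_fun f m"
      by (rule duality_invariant[OF assms orthogonal_group_uminus])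
        (use sets sym in \<open>auto simp: distr_borel_id sym_measure_def sym_fun_def\<close>)
    ultimately show "(SUP \<nu>\<in>Ps1. ext_integral \<nu> (\<lambda>x. - f x) - K_fun \<nu> m) = L_fun f m" by simp
  }
qed

end
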